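(* Let $S$ be a left cancellative left reversible semigroup and let $G$ be a group. Then for every homomorphism $\phi:S\to G$ there exists a $*$-homomorphism $\pi_\phi:C^*(I_l(S))\to C^*(G)$ such that $\pi_\phi(\lambda_s)=\lambda_{\phi(s)}$ for each $s\in S$, where $\lambda_{\phi(s)}$ denotes the canonical unitary in $C^*(G)$ corresponding to $\phi(s)\in G$.
   Context: A semigroup means a set with associative product and identity element $1$; homomorphisms preserve identities. $S$ is left cancellative if $sr=st$ implies $r=t$, and left reversible if $sS\cap tS\ne\varnothing$ for all $s,t\in S$. For $s\in S$ let $\lambda_s:S\to sS$, $\lambda_s(t)=st$. $I(S)$ is the inverse semigroup of all partially defined bijections of $S$ (product $fg$ is composition on $g^{-1}(\mathrm{dom} f)$; $f^*$ is the inverse map). $I_l(S)$ is the inverse subsemigroup of $I(S)$ generated by $\{\lambda_s\}_{s\in S}$. For an inverse semigroup $P$, $C^*(P)$ is the full $C^*$-algebra of $P$: the enveloping $C^*$-algebra of the convolution algebra $\ell^1(P)$, universal for representations of $P$ by partial isometries (homomorphisms $P\to A$, $A$ a $C^*$-algebra, onto a multiplicative semigroup of partial isometries); $P$ is identified with its image in $C^*(P)$. $C^*(G)$ is the full group $C^*$-algebra of the discrete group $G$. *)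

theory Defs
  imports "HOL-Analysis.Infinite_Sum" "HOL-Algebra.Coset" "HOL-Algebra.Ring"
begin

section \<open>Semigroups of partial bijections\<close>

text \<open>Semigroups have an identity, so they are rendered by the locale \<^locale>\<open>monoid\<close>.\<close>

definition left_cancellative :: "('s, 'm) monoid_scheme \<Rightarrow> bool" where
  "left_cancellative S \<longleftrightarrow>
    (\<forall>s \<in> carrier S. \<forall>r \<in> carrier S. \<forall>t \<in> carrier S. s \<otimes>\<^bsub>S\<^esub> r = s \<otimes>\<^bsub>S\<^esub> t \<longrightarrow> r = t)"

definition left_reversible :: "('s, 'm) monoid_scheme \<Rightarrow> bool" where
  "left_reversible S \<longleftrightarrow>
    (\<forall>s \<in> carrier S. \<forall>t \<in> carrier S. (s <#\<^bsub>S\<^esub> carrier S) \<inter> (t <#\<^bsub>S\<^esub> carrier S) \<noteq> {})"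

definition inverse_semigroup :: "('p, 'm) monoid_scheme \<Rightarrow> bool" where
  "inverse_semigroup P \<longleftrightarrow> monoid P \<and>
    (\<forall>x \<in> carrier P. \<exists>!y. y \<in> carrier P \<and> x \<otimes>\<^bsub>P\<^esub> y \<otimes>\<^bsub>P\<^esub> x = x \<and> y \<otimes>\<^bsub>P\<^esub> x \<otimes>\<^bsub>P\<^esub> y = y)"

definition semigroup_inv :: "('p, 'm) monoid_scheme \<Rightarrow> 'p \<Rightarrow> 'p" where
  "semigroup_inv P x =
    (THE y. y \<in> carrier P \<and> x \<otimes>\<^bsub>P\<^esub> y \<otimes>\<^bsub>P\<^esub> x = x \<and> y \<otimes>\<^bsub>P\<^esub> x \<otimes>\<^bsub>P\<^esub> y = y)"

text \<open>
  A partially defined map is a \<open>'s \<rightharpoonup> 's\<close>. The library composition \<open>f \<circ>\<^sub>m g\<close> is defined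
  exactly on the preimage of the domain of \<open>f\<close> under \<open>g\<close>.
\<close>

definition partial_bijections :: "'s set \<Rightarrow> ('s \<rightharpoonup> 's) set" where
  "partial_bijections X = {f. dom f \<subseteq> X \<and> ran f \<subseteq> X \<and> inj_on f (dom f)}"

definition partial_inv :: "('s \<rightharpoonup> 's) \<Rightarrow> ('s \<rightharpoonup> 's)" where
  "partial_inv f = (\<lambda>y. if y \<in> ran f then Some (THE x. f x = Some y) else None)"

definition symmetric_inverse_semigroup :: "'s set \<Rightarrow> ('s \<rightharpoonup> 's) monoid" where
  "symmetric_inverse_semigroup X =
    \<lparr>carrier = partial_bijections X, mult = (\<circ>\<^sub>m), one = Some |` X\<rparr>"

definition left_translation :: "('s, 'm) monoid_scheme \<Rightarrow> 's \<Rightarrow> ('s \<rightharpoonup> 's)" where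
  "left_translation S s = (\<lambda>t. if t \<in> carrier S then Some (s \<otimes>\<^bsub>S\<^esub> t) else None)"

inductive_set inverse_generate :: "('s \<rightharpoonup> 's) set \<Rightarrow> ('s \<rightharpoonup> 's) set" for F where
  incl: "f \<in> F \<Longrightarrow> f \<in> inverse_generate F"
| comp: "f \<in> inverse_generate F \<Longrightarrow> g \<in> inverse_generate F \<Longrightarrow> f \<circ>\<^sub>m g \<in> inverse_generate F"
| inv: "f \<in> inverse_generate F \<Longrightarrow> partial_inv f \<in> inverse_generate F"

text \<open>
  The left inverse hull \<open>I\<^sub>l(S)\<close>, with the multiplication and identity of the symmetric inverse
  semigroup; the identity is the translation by the identity of \<open>S\<close>.
\<close>

definition left_inverse_hull :: "('s, 'm) monoid_scheme \<Rightarrow> ('s \<rightharpoonup> 's) monoid" where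
  "left_inverse_hull S =
    (symmetric_inverse_semigroup (carrier S))
      \<lparr>carrier := inverse_generate (left_translation S ` carrier S)\<rparr>"


section \<open>Complex *-algebras\<close>

text \<open>All algebras below come from semigroups with identity, hence are unital.\<close>

record 'a star_alg = "'a ring" +
  cscale :: "complex \<Rightarrow> 'a \<Rightarrow> 'a"
  adj :: "'a \<Rightarrow> 'a"
  nrm :: "'a \<Rightarrow> real"

locale normed_star_algebra = ring A for A :: "'a star_alg" (structure) +
  assumes cscale_closed: "a \<in> carrier A \<Longrightarrow> cscale A c a \<in> carrier A"
    and cscale_add: "a \<in> carrier A \<Longrightarrow> b \<in> carrier A \<Longrightarrow>
          cscale A c (a \<oplus> b) = cscale A c a \<oplus> cscale A c b"
    and add_cscale: "a \<in> carrier A \<Longrightarrow> cscale A (c + d) a = cscale A c a \<oplus> cscale A d a"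
    and cscale_cscale: "a \<in> carrier A \<Longrightarrow> cscale A c (cscale A d a) = cscale A (c * d) a"
    and cscale_one: "a \<in> carrier A \<Longrightarrow> cscale A 1 a = a"
    and cscale_mult_left: "a \<in> carrier A \<Longrightarrow> b \<in> carrier A \<Longrightarrow>
          cscale A c a \<otimes> b = cscale A c (a \<otimes> b)"
    and cscale_mult_right: "a \<in> carrier A \<Longrightarrow> b \<in> carrier A \<Longrightarrow>
          a \<otimes> cscale A c b = cscale A c (a \<otimes> b)"
    and adj_closed: "a \<in> carrier A \<Longrightarrow> adj A a \<in> carrier A"
    and adj_add: "a \<in> carrier A \<Longrightarrow> b \<in> carrier A \<Longrightarrow> adj A (a \<oplus> b) = adj A a \<oplus> adj A b"
    and adj_cscale: "a \<in> carrier A \<Longrightarrow> adj A (cscale A c a) = cscale A (cnj c) (adj A a)"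
    and adj_mult: "a \<in> carrier A \<Longrightarrow> b \<in> carrier A \<Longrightarrow> adj A (a \<otimes> b) = adj A b \<otimes> adj A a"
    and adj_adj: "a \<in> carrier A \<Longrightarrow> adj A (adj A a) = a"
    and nrm_nonneg: "a \<in> carrier A \<Longrightarrow> 0 \<le> nrm A a"
    and nrm_eq_0: "a \<in> carrier A \<Longrightarrow> nrm A a = 0 \<longleftrightarrow> a = \<zero>"
    and nrm_triangle: "a \<in> carrier A \<Longrightarrow> b \<in> carrier A \<Longrightarrow> nrm A (a \<oplus> b) \<le> nrm A a + nrm A b"
    and nrm_cscale: "a \<in> carrier A \<Longrightarrow> nrm A (cscale A c a) = cmod c * nrm A a"
    and nrm_mult: "a \<in> carrier A \<Longrightarrow> b \<in> carrier A \<Longrightarrow> nrm A (a \<otimes> b) \<le> nrm A a * nrm A b"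
    and nrm_adj: "a \<in> carrier A \<Longrightarrow> nrm A (adj A a) = nrm A a"

definition cauchy_seqs :: "'a star_alg \<Rightarrow> ('a \<Rightarrow> real) \<Rightarrow> (nat \<Rightarrow> 'a) set" where
  "cauchy_seqs A p = {x. (\<forall>n. x n \<in> carrier A) \<and>
    (\<forall>e > 0. \<exists>N. \<forall>m \<ge> N. \<forall>n \<ge> N. p (x m \<ominus>\<^bsub>A\<^esub> x n) < e)}"

locale cstar_algebra = normed_star_algebra +
  assumes cstar_identity: "a \<in> carrier A \<Longrightarrow> nrm A (adj A a \<otimes> a) = (nrm A a)\<^sup>2"
    and complete: "x \<in> cauchy_seqs A (nrm A) \<Longrightarrow>
          \<exists>a \<in> carrier A. (\<lambda>n. nrm A (x n \<ominus> a)) \<longlonglongrightarrow> 0"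

definition star_hom :: "'a star_alg \<Rightarrow> 'b star_alg \<Rightarrow> ('a \<Rightarrow> 'b) set" where
  "star_hom A B = {\<pi>. \<pi> \<in> carrier A \<rightarrow> carrier B \<and>
    (\<forall>a \<in> carrier A. \<forall>b \<in> carrier A. \<pi> (a \<oplus>\<^bsub>A\<^esub> b) = \<pi> a \<oplus>\<^bsub>B\<^esub> \<pi> b) \<and>
    (\<forall>a \<in> carrier A. \<forall>b \<in> carrier A. \<pi> (a \<otimes>\<^bsub>A\<^esub> b) = \<pi> a \<otimes>\<^bsub>B\<^esub> \<pi> b) \<and>
    (\<forall>a \<in> carrier A. \<forall>c. \<pi> (cscale A c a) = cscale B c (\<pi> a)) \<and>
    (\<forall>a \<in> carrier A. \<pi> (adj A a) = adj B (\<pi> a))}"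


section \<open>Enveloping C*-algebras\<close>

text \<open>
  The bound by the given norm is automatic on a Banach *-algebra with isometric involution; it is
  part of the definition so that the supremum below is visibly finite.
\<close>

definition cstar_seminorm :: "'a star_alg \<Rightarrow> ('a \<Rightarrow> real) \<Rightarrow> bool" where
  "cstar_seminorm A p \<longleftrightarrow>
    (\<forall>a \<in> carrier A. 0 \<le> p a \<and> p a \<le> nrm A a) \<and>
    (\<forall>a \<in> carrier A. \<forall>b \<in> carrier A. p (a \<oplus>\<^bsub>A\<^esub> b) \<le> p a + p b) \<and>
    (\<forall>a \<in> carrier A. \<forall>c. p (cscale A c a) = cmod c * p a) \<and>
    (\<forall>a \<in> carrier A. \<forall>b \<in> carrier A. p (a \<otimes>\<^bsub>A\<^esub> b) \<le> p a * p b) \<and>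
    (\<forall>a \<in> carrier A. p (adj A a \<otimes>\<^bsub>A\<^esub> a) = (p a)\<^sup>2)"

definition enveloping_seminorm :: "'a star_alg \<Rightarrow> 'a \<Rightarrow> real" where
  "enveloping_seminorm A a = (SUP p \<in> {p. cstar_seminorm A p}. p a)"

text \<open>
  Hausdorff completion with respect to a seminorm: Cauchy sequences modulo sequences converging
  to zero, so that the null space of the seminorm is divided out as well.
\<close>

definition null_rel :: "'a star_alg \<Rightarrow> ('a \<Rightarrow> real) \<Rightarrow> (nat \<Rightarrow> 'a) rel" where
  "null_rel A p = {(x, y). x \<in> cauchy_seqs A p \<and> y \<in> cauchy_seqs A p \<and>
    (\<lambda>n. p (x n \<ominus>\<^bsub>A\<^esub> y n)) \<longlonglongrightarrow> 0}"

definition hausdorff_completion :: "'a star_alg \<Rightarrow> ('a \<Rightarrow> real) \<Rightarrow> (nat \<Rightarrow> 'a) set star_alg" where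
  "hausdorff_completion A p =
    \<lparr>carrier = cauchy_seqs A p // null_rel A p,
     mult = (\<lambda>X Y. \<Union>x \<in> X. \<Union>y \<in> Y. null_rel A p `` {\<lambda>n. x n \<otimes>\<^bsub>A\<^esub> y n}),
     one = null_rel A p `` {\<lambda>n. \<one>\<^bsub>A\<^esub>},
     zero = null_rel A p `` {\<lambda>n. \<zero>\<^bsub>A\<^esub>},
     add = (\<lambda>X Y. \<Union>x \<in> X. \<Union>y \<in> Y. null_rel A p `` {\<lambda>n. x n \<oplus>\<^bsub>A\<^esub> y n}),
     cscale = (\<lambda>c X. \<Union>x \<in> X. null_rel A p `` {\<lambda>n. cscale A c (x n)}),
     adj = (\<lambda>X. \<Union>x \<in> X. null_rel A p `` {\<lambda>n. adj A (x n)}),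
     nrm = (\<lambda>X. THE l. \<forall>x \<in> X. (\<lambda>n. p (x n)) \<longlonglongrightarrow> l)\<rparr>"

definition enveloping_cstar :: "'a star_alg \<Rightarrow> (nat \<Rightarrow> 'a) set star_alg" where
  "enveloping_cstar A = hausdorff_completion A (enveloping_seminorm A)"

definition enveloping_map :: "'a star_alg \<Rightarrow> 'a \<Rightarrow> (nat \<Rightarrow> 'a) set" where
  "enveloping_map A a = null_rel A (enveloping_seminorm A) `` {\<lambda>n. a}"


section \<open>The C*-algebras of an inverse semigroup and of a group\<close>

text \<open>
  The convolution algebra \<open>\<ell>\<^sup>1(P)\<close> of a semigroup \<open>P\<close> with an involution \<open>i\<close>. Its elements are
  extended by zero outside the carrier of \<open>P\<close>.
\<close>

definition l1_algebra :: "('p, 'm) monoid_scheme \<Rightarrow> ('p \<Rightarrow> 'p) \<Rightarrow> ('p \<Rightarrow> complex) star_alg" where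
  "l1_algebra P i =
    \<lparr>carrier = {a. a abs_summable_on carrier P \<and> (\<forall>r. r \<notin> carrier P \<longrightarrow> a r = 0)},
     mult = (\<lambda>a b r. \<Sum>\<^sub>\<infinity>(s, t) \<in> {(s, t). s \<in> carrier P \<and> t \<in> carrier P \<and> s \<otimes>\<^bsub>P\<^esub> t = r}. a s * b t),
     one = (\<lambda>r. if r = \<one>\<^bsub>P\<^esub> then 1 else 0),
     zero = (\<lambda>r. 0),
     add = (\<lambda>a b r. a r + b r),
     cscale = (\<lambda>c a r. c * a r),
     adj = (\<lambda>a r. if r \<in> carrier P then cnj (a (i r)) else 0),
     nrm = (\<lambda>a. \<Sum>\<^sub>\<infinity>r \<in> carrier P. cmod (a r))\<rparr>"

definition inverse_semigroup_cstar :: "('p, 'm) monoid_scheme \<Rightarrow> (nat \<Rightarrow> 'p \<Rightarrow> complex) set star_alg" where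
  "inverse_semigroup_cstar P = enveloping_cstar (l1_algebra P (semigroup_inv P))"

definition inverse_semigroup_elt :: "('p, 'm) monoid_scheme \<Rightarrow> 'p \<Rightarrow> (nat \<Rightarrow> 'p \<Rightarrow> complex) set" where
  "inverse_semigroup_elt P s =
    enveloping_map (l1_algebra P (semigroup_inv P)) (\<lambda>r. if r = s then 1 else 0)"

definition group_cstar :: "('g, 'm) monoid_scheme \<Rightarrow> (nat \<Rightarrow> 'g \<Rightarrow> complex) set star_alg" where
  "group_cstar G = enveloping_cstar (l1_algebra G (m_inv G))"

definition group_elt :: "('g, 'm) monoid_scheme \<Rightarrow> 'g \<Rightarrow> (nat \<Rightarrow> 'g \<Rightarrow> complex) set" where
  "group_elt G g = enveloping_map (l1_algebra G (m_inv G)) (\<lambda>r. if r = g then 1 else 0)"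


section \<open>Adequacy of the constructions\<close>

text \<open>
  The enveloping algebra is a C*-algebra through which every contractive *-homomorphism to a
  C*-algebra factors; \<open>\<ell>\<^sup>1\<close> is a normed *-algebra; the left inverse hull of a left cancellative
  semigroup is an inverse semigroup whose abstract inversion is inversion of partial bijections.
\<close>

subsection \<open>Hausdorff completions and enveloping C*-algebras\<close>

context normed_star_algebra
begin

lemma cscale_0: "a \<in> carrier A \<Longrightarrow> cscale A 0 a = \<zero>"
proof -
  assume a: "a \<in> carrier A"
  have "cscale A 0 a = cscale A 0 a \<oplus> cscale A 0 a"
    using add_cscale[OF a, of 0 0] by simp
  then show ?thesis
    using cscale_closed[OF a, of 0] by (metis add.l_cancel_one')
qed

lemma cscale_m1: "a \<in> carrier A \<Longrightarrow> cscale A (-1) a = \<ominus> a"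
proof -
  assume a: "a \<in> carrier A"
  have "cscale A (-1) a \<oplus> a = \<zero>"
    using add_cscale[OF a, of "-1" 1] cscale_one[OF a] cscale_0[OF a] by simp
  then show ?thesis using cscale_closed[OF a] a by (metis minus_equality)
qed

end

locale cstar_seminormed = normed_star_algebra +
  fixes p :: "'a \<Rightarrow> real"
  assumes seminorm: "cstar_seminorm A p"
begin

lemma p_nonneg: "a \<in> carrier A \<Longrightarrow> 0 \<le> p a"
  and p_le: "a \<in> carrier A \<Longrightarrow> p a \<le> nrm A a"
  and p_add: "a \<in> carrier A \<Longrightarrow> b \<in> carrier A \<Longrightarrow> p (a \<oplus> b) \<le> p a + p b"
  and p_cscale: "a \<in> carrier A \<Longrightarrow> p (cscale A c a) = cmod c * p a"
  and p_mult: "a \<in> carrier A \<Longrightarrow> b \<in> carrier A \<Longrightarrow> p (a \<otimes> b) \<le> p a * p b"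
  and p_cstar: "a \<in> carrier A \<Longrightarrow> p (adj A a \<otimes> a) = (p a)\<^sup>2"
  using seminorm by (auto simp: cstar_seminorm_def)

lemma p_adj: assumes a: "a \<in> carrier A" shows "p (adj A a) = p a"
proof -
  have le: "p b \<le> p (adj A b)" if b: "b \<in> carrier A" for b
  proof (cases "p b = 0")
    case True then show ?thesis using p_nonneg[OF adj_closed[OF b]] by simp
  next
    case False
    have "p b * p b \<le> p (adj A b) * p b"
      using p_cstar[OF b] p_mult[OF adj_closed[OF b] b] by (simp add: power2_eq_square)
    then show ?thesis using False p_nonneg[OF b] by simp
  qed
  show ?thesis using le[OF a] le[OF adj_closed[OF a]] adj_adj[OF a] by simp
qed

lemma p_zero: "p \<zero> = 0"
  using p_cscale[of \<zero> 0] cscale_0[of \<zero>] by simp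

lemma p_uminus: "a \<in> carrier A \<Longrightarrow> p (\<ominus> a) = p a"
  using p_cscale[of a "-1"] cscale_m1[of a] by simp

definition dst :: "'a \<Rightarrow> 'a \<Rightarrow> real" where "dst x y = p (x \<ominus> y)"

lemma dst_refl: "x \<in> carrier A \<Longrightarrow> dst x x = 0"
  by (simp add: dst_def p_zero r_neg a_minus_def)

lemma dst_nonneg: "x \<in> carrier A \<Longrightarrow> y \<in> carrier A \<Longrightarrow> 0 \<le> dst x y"
  by (simp add: dst_def p_nonneg)

lemma dst_sym: assumes "x \<in> carrier A" "y \<in> carrier A" shows "dst x y = dst y x"
proof -
  have "\<ominus> (x \<ominus> y) = y \<ominus> x" using assms by (simp add: a_minus_def minus_add a_comm)
  then show ?thesis using p_uminus[of "x \<ominus> y"] assms by (simp add: dst_def)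
qed

lemma dst_triangle: 
  assumes "x \<in> carrier A" "y \<in> carrier A" "z \<in> carrier A"
  shows "dst x z \<le> dst x y + dst y z"
proof -
  have "(x \<ominus> y) \<oplus> (y \<ominus> z) = x \<ominus> z"
    using assms by (simp add: a_minus_def) (metis a_assoc a_inv_closed add.m_closed r_neg1)
  then show ?thesis using p_add[of "x \<ominus> y" "y \<ominus> z"] assms by (simp add: dst_def)
qed

lemma p_dst: assumes "x \<in> carrier A" "y \<in> carrier A" shows "\<bar>p x - p y\<bar> \<le> dst x y"
proof -
  have le: "p x \<le> p y + dst x y" if "x \<in> carrier A" "y \<in> carrier A" for x y
  proof -
    have "y \<oplus> (x \<ominus> y) = x" using that
      by (simp add: a_minus_def) (metis a_inv_closed a_lcomm r_neg r_zero)
    then show ?thesis using p_add[of y "x \<ominus> y"] that by (simp add: dst_def)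
  qed
  show ?thesis using le[of x y] le[of y x] dst_sym[of x y] assms by linarith
qed

lemma dst_add:
  assumes "x \<in> carrier A" "y \<in> carrier A" "x' \<in> carrier A" "y' \<in> carrier A"
  shows "dst (x \<oplus> y) (x' \<oplus> y') \<le> dst x x' + dst y y'"
proof -
  have "(x \<oplus> y) \<ominus> (x' \<oplus> y') = (x \<ominus> x') \<oplus> (y \<ominus> y')"
    using assms by (simp add: a_minus_def minus_add a_ac)
  then show ?thesis using p_add[of "x \<ominus> x'" "y \<ominus> y'"] assms by (simp add: dst_def)
qed

lemma dst_cscale:
  assumes "x \<in> carrier A" "y \<in> carrier A"
  shows "dst (cscale A c x) (cscale A c y) = cmod c * dst x y"
proof -
  have "cscale A c x \<ominus> cscale A c y = cscale A c (x \<ominus> y)"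
    using assms by (simp add: a_minus_def cscale_m1[symmetric] cscale_add cscale_cscale cscale_closed)
  then show ?thesis using p_cscale assms by (simp add: dst_def)
qed

lemma dst_adj:
  assumes "x \<in> carrier A" "y \<in> carrier A"
  shows "dst (adj A x) (adj A y) = dst x y"
proof -
  have "adj A x \<ominus> adj A y = adj A (x \<ominus> y)"
    using assms by (simp add: a_minus_def cscale_m1[symmetric] adj_add adj_cscale cscale_closed adj_closed)
  then show ?thesis using p_adj assms by (simp add: dst_def)
qed

lemma dst_mult:
  assumes "x \<in> carrier A" "y \<in> carrier A" "x' \<in> carrier A" "y' \<in> carrier A"
  shows "dst (x \<otimes> y) (x' \<otimes> y') \<le> p x * dst y y' + dst x x' * p y'"
proof -
  have "dst (x \<otimes> y) (x' \<otimes> y') \<le> dst (x \<otimes> y) (x \<otimes> y') + dst (x \<otimes> y') (x' \<otimes> y')"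
    using assms by (intro dst_triangle) auto
  also have "dst (x \<otimes> y) (x \<otimes> y') \<le> p x * dst y y'"
  proof -
    have "x \<otimes> y \<ominus> x \<otimes> y' = x \<otimes> (y \<ominus> y')" using assms by (simp add: a_minus_def r_distr r_minus)
    then show ?thesis using p_mult[of x "y \<ominus> y'"] assms by (simp add: dst_def)
  qed
  also have "dst (x \<otimes> y') (x' \<otimes> y') \<le> dst x x' * p y'"
  proof -
    have "x \<otimes> y' \<ominus> x' \<otimes> y' = (x \<ominus> x') \<otimes> y'" using assms by (simp add: a_minus_def l_distr l_minus)
    then show ?thesis using p_mult[of "x \<ominus> x'" y'] assms by (simp add: dst_def)
  qed
  finally show ?thesis by simp
qed

abbreviation "CS \<equiv> cauchy_seqs A p"
abbreviation "NR \<equiv> null_rel A p"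
definition cl :: "(nat \<Rightarrow> 'a) \<Rightarrow> (nat \<Rightarrow> 'a) set" where "cl x = NR `` {x}"

lemma CS_iff: "x \<in> CS \<longleftrightarrow> (\<forall>n. x n \<in> carrier A) \<and>
    (\<forall>e > 0. \<exists>N. \<forall>m \<ge> N. \<forall>n \<ge> N. dst (x m) (x n) < e)"
  by (simp add: cauchy_seqs_def dst_def)

lemma CS_D: "x \<in> CS \<Longrightarrow> x n \<in> carrier A" by (simp add: CS_iff)

lemma NR_iff: "(x, y) \<in> NR \<longleftrightarrow> x \<in> CS \<and> y \<in> CS \<and> (\<lambda>n. dst (x n) (y n)) \<longlonglongrightarrow> 0"
  by (simp add: null_rel_def dst_def)

lemma tendsto_0_le: 
  assumes "g \<longlonglongrightarrow> (0::real)" "\<And>n. 0 \<le> f n" "\<And>n. f n \<le> g n" shows "f \<longlonglongrightarrow> 0"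
  by (rule tendsto_sandwich[OF _ _ tendsto_const assms(1)]) (auto simp: assms)

lemma equiv_NR: "equiv CS NR"
proof (rule equivI)
  show "NR \<subseteq> CS \<times> CS" by (auto simp: null_rel_def)
  show "refl_on CS NR"
    by (rule refl_onI) (auto simp: NR_iff CS_D dst_refl)
  show "sym NR"
  proof (rule symI)
    fix x y assume "(x, y) \<in> NR"
    then have xy: "x \<in> CS" "y \<in> CS" "(\<lambda>n. dst (x n) (y n)) \<longlonglongrightarrow> 0" by (simp_all add: NR_iff)
    then have "(\<lambda>n. dst (y n) (x n)) = (\<lambda>n. dst (x n) (y n))"
      by (auto simp: CS_D dst_sym)
    with xy show "(y, x) \<in> NR" by (simp add: NR_iff)
  qed
  show "trans NR"
  proof (rule transI)
    fix x y z assume "(x, y) \<in> NR" "(y, z) \<in> NR"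
    then have h: "x \<in> CS" "y \<in> CS" "z \<in> CS" "(\<lambda>n. dst (x n) (y n)) \<longlonglongrightarrow> 0" "(\<lambda>n. dst (y n) (z n)) \<longlonglongrightarrow> 0"
      by (simp_all add: NR_iff)
    have "(\<lambda>n. dst (x n) (y n) + dst (y n) (z n)) \<longlonglongrightarrow> 0" using tendsto_add[OF h(4,5)] by simp
    then have "(\<lambda>n. dst (x n) (z n)) \<longlonglongrightarrow> 0"
      by (rule tendsto_0_le) (auto intro!: dst_nonneg dst_triangle simp: CS_D h)
    then show "(x, z) \<in> NR" using h by (simp add: NR_iff)
  qed
qed

lemma cl_eq_iff: "x \<in> CS \<Longrightarrow> y \<in> CS \<Longrightarrow> cl x = cl y \<longleftrightarrow> (x, y) \<in> NR"
  unfolding cl_def using eq_equiv_class_iff[OF equiv_NR] by blast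

lemma cl_in: "x \<in> CS \<Longrightarrow> cl x \<in> CS // NR" unfolding cl_def by (rule quotientI)

lemma in_clE: assumes "X \<in> CS // NR" obtains x where "x \<in> CS" "X = cl x"
  using assms unfolding cl_def by (rule quotientE)

lemma in_cl: "x \<in> CS \<Longrightarrow> y \<in> cl x \<longleftrightarrow> (x, y) \<in> NR" by (simp add: cl_def)

lemma p_Cauchy: assumes "x \<in> CS" shows "Cauchy (\<lambda>n. p (x n))"
proof (rule metric_CauchyI)
  fix e :: real assume "e > 0"
  then obtain N where "\<forall>m \<ge> N. \<forall>n \<ge> N. dst (x m) (x n) < e" using assms by (auto simp: CS_iff)
  then have "\<forall>m \<ge> N. \<forall>n \<ge> N. dist (p (x m)) (p (x n)) < e"
    unfolding dist_real_def using p_dst[OF CS_D[OF assms] CS_D[OF assms]] le_less_trans by blast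
  then show "\<exists>M. \<forall>m\<ge>M. \<forall>n\<ge>M. dist (p (x m)) (p (x n)) < e" by blast
qed

lemma p_conv: assumes "x \<in> CS" obtains l where "(\<lambda>n. p (x n)) \<longlonglongrightarrow> l"
  using p_Cauchy[OF assms] by (auto simp: Cauchy_convergent_iff convergent_def)

lemma p_bounded: assumes "x \<in> CS" obtains K where "K > 0" "\<And>n. p (x n) \<le> K"
proof -
  have "Bseq (\<lambda>n. p (x n))" by (rule Cauchy_Bseq[OF p_Cauchy[OF assms]])
  then obtain K where "K > 0" "\<forall>n. norm (p (x n)) \<le> K" by (auto simp: Bseq_def)
  then show thesis using that[of K] by (auto simp: abs_le_iff)
qed

lemma CS_const: "a \<in> carrier A \<Longrightarrow> (\<lambda>n. a) \<in> CS" by (auto simp: CS_iff dst_refl)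

lemma CS_add: assumes x: "x \<in> CS" and y: "y \<in> CS" shows "(\<lambda>n. x n \<oplus> y n) \<in> CS"
  unfolding CS_iff
proof (intro conjI allI impI)
  show "x n \<oplus> y n \<in> carrier A" for n using CS_D x y by auto
  fix e :: real assume "e > 0"
  then have "e/2 > 0" by simp
  then obtain N M where N: "\<forall>m \<ge> N. \<forall>n \<ge> N. dst (x m) (x n) < e/2" and M: "\<forall>m \<ge> M. \<forall>n \<ge> M. dst (y m) (y n) < e/2"
    using x y unfolding CS_iff by metis
  show "\<exists>N. \<forall>m \<ge> N. \<forall>n \<ge> N. dst (x m \<oplus> y m) (x n \<oplus> y n) < e"
  proof (intro exI[of _ "max N M"] allI impI)
    fix m n assume "max N M \<le> m" "max N M \<le> n"
    then have "dst (x m) (x n) < e/2" "dst (y m) (y n) < e/2" using N M by auto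
    moreover have "dst (x m \<oplus> y m) (x n \<oplus> y n) \<le> dst (x m) (x n) + dst (y m) (y n)"
      using dst_add CS_D x y by auto
    ultimately show "dst (x m \<oplus> y m) (x n \<oplus> y n) < e" by linarith
  qed
qed

lemma CS_mult: assumes x: "x \<in> CS" and y: "y \<in> CS" shows "(\<lambda>n. x n \<otimes> y n) \<in> CS"
  unfolding CS_iff
proof (intro conjI allI impI)
  show "x n \<otimes> y n \<in> carrier A" for n using CS_D x y by auto
  fix e :: real assume e: "e > 0"
  obtain K where K: "K > 0" "\<And>n. p (x n) \<le> K" using p_bounded[OF x] by blast
  obtain L where L: "L > 0" "\<And>n. p (y n) \<le> L" using p_bounded[OF y] by blast
  have "e/2/K > 0" "e/2/L > 0" using e K L by auto
  then obtain N M where N: "\<forall>m \<ge> N. \<forall>n \<ge> N. dst (x m) (x n) < e/2/L" and M: "\<forall>m \<ge> M. \<forall>n \<ge> M. dst (y m) (y n) < e/2/K"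
    using x y unfolding CS_iff by metis
  show "\<exists>N. \<forall>m \<ge> N. \<forall>n \<ge> N. dst (x m \<otimes> y m) (x n \<otimes> y n) < e"
  proof (intro exI[of _ "max N M"] allI impI)
    fix m n assume "max N M \<le> m" "max N M \<le> n"
    then have 1: "dst (x m) (x n) < e/2/L" "dst (y m) (y n) < e/2/K" using N M by auto
    have "dst (x m \<otimes> y m) (x n \<otimes> y n) \<le> p (x m) * dst (y m) (y n) + dst (x m) (x n) * p (y n)"
      using dst_mult CS_D x y by auto
    also have "\<dots> \<le> K * dst (y m) (y n) + dst (x m) (x n) * L"
      using K L CS_D x y by (intro add_mono mult_right_mono mult_left_mono) (auto intro: dst_nonneg)
    also have "\<dots> < K * (e/2/K) + e/2/L * L"
      using 1 K(1) L(1) by (intro add_strict_mono mult_strict_left_mono mult_strict_right_mono)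
    also have "\<dots> = e" using K(1) L(1) by simp
    finally show "dst (x m \<otimes> y m) (x n \<otimes> y n) < e" .
  qed
qed

lemma CS_cscale: assumes x: "x \<in> CS" shows "(\<lambda>n. cscale A c (x n)) \<in> CS"
  unfolding CS_iff
proof (intro conjI allI impI)
  show "cscale A c (x n) \<in> carrier A" for n using CS_D x cscale_closed by auto
  fix e :: real assume e: "e > 0"
  have "e / (cmod c + 1) > 0" using e by (simp add: add_nonneg_pos)
  then obtain N where N: "\<forall>m \<ge> N. \<forall>n \<ge> N. dst (x m) (x n) < e / (cmod c + 1)"
    using x unfolding CS_iff by metis
  show "\<exists>N. \<forall>m \<ge> N. \<forall>n \<ge> N. dst (cscale A c (x m)) (cscale A c (x n)) < e"
  proof (intro exI[of _ N] allI impI)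
    fix m n assume "N \<le> m" "N \<le> n"
    then have 1: "dst (x m) (x n) < e / (cmod c + 1)" using N by auto
    have "dst (cscale A c (x m)) (cscale A c (x n)) = cmod c * dst (x m) (x n)"
      using dst_cscale CS_D x by auto
    also have "\<dots> \<le> (cmod c + 1) * dst (x m) (x n)" using dst_nonneg CS_D x by (intro mult_right_mono) auto
    also have "\<dots> < (cmod c + 1) * (e / (cmod c + 1))"
      using 1 by (intro mult_strict_left_mono) (auto simp: add_nonneg_pos)
    also have "\<dots> = e" by (metis add_nonneg_pos norm_ge_zero less_numeral_extra(1,3) nonzero_mult_div_cancel_left times_divide_eq_right)
    finally show "dst (cscale A c (x m)) (cscale A c (x n)) < e" .
  qed
qed

lemma CS_adj: assumes x: "x \<in> CS" shows "(\<lambda>n. adj A (x n)) \<in> CS"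
  using x by (auto simp: CS_iff adj_closed dst_adj)

lemma NR_add: assumes "(x, x') \<in> NR" "(y, y') \<in> NR" shows "((\<lambda>n. x n \<oplus> y n), (\<lambda>n. x' n \<oplus> y' n)) \<in> NR"
proof -
  have h: "x \<in> CS" "x' \<in> CS" "y \<in> CS" "y' \<in> CS" "(\<lambda>n. dst (x n) (x' n)) \<longlonglongrightarrow> 0" "(\<lambda>n. dst (y n) (y' n)) \<longlonglongrightarrow> 0"
    using assms by (simp_all add: NR_iff)
  have "(\<lambda>n. dst (x n) (x' n) + dst (y n) (y' n)) \<longlonglongrightarrow> 0" using tendsto_add[OF h(5,6)] by simp
  then have "(\<lambda>n. dst (x n \<oplus> y n) (x' n \<oplus> y' n)) \<longlonglongrightarrow> 0"
    by (rule tendsto_0_le) (auto intro!: dst_nonneg dst_add simp: CS_D h)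
  then show ?thesis using h by (simp add: NR_iff CS_add)
qed

lemma NR_mult: assumes "(x, x') \<in> NR" "(y, y') \<in> NR" shows "((\<lambda>n. x n \<otimes> y n), (\<lambda>n. x' n \<otimes> y' n)) \<in> NR"
proof -
  have h: "x \<in> CS" "x' \<in> CS" "y \<in> CS" "y' \<in> CS" "(\<lambda>n. dst (x n) (x' n)) \<longlonglongrightarrow> 0" "(\<lambda>n. dst (y n) (y' n)) \<longlonglongrightarrow> 0"
    using assms by (simp_all add: NR_iff)
  obtain l where l: "(\<lambda>n. p (x n)) \<longlonglongrightarrow> l" using p_conv[OF h(1)] by blast
  obtain k where k: "(\<lambda>n. p (y' n)) \<longlonglongrightarrow> k" using p_conv[OF h(4)] by blast
  have "(\<lambda>n. p (x n) * dst (y n) (y' n) + dst (x n) (x' n) * p (y' n)) \<longlonglongrightarrow> l * 0 + 0 * k"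
    by (intro tendsto_intros l k h)
  then have "(\<lambda>n. p (x n) * dst (y n) (y' n) + dst (x n) (x' n) * p (y' n)) \<longlonglongrightarrow> 0" by simp
  then have "(\<lambda>n. dst (x n \<otimes> y n) (x' n \<otimes> y' n)) \<longlonglongrightarrow> 0"
    by (rule tendsto_0_le) (auto intro!: dst_nonneg dst_mult simp: CS_D h)
  then show ?thesis using h by (simp add: NR_iff CS_mult)
qed

lemma NR_cscale: assumes "(x, x') \<in> NR" shows "((\<lambda>n. cscale A c (x n)), (\<lambda>n. cscale A c (x' n))) \<in> NR"
proof -
  have h: "x \<in> CS" "x' \<in> CS" "(\<lambda>n. dst (x n) (x' n)) \<longlonglongrightarrow> 0" using assms by (simp_all add: NR_iff)
  have "(\<lambda>n. cmod c * dst (x n) (x' n)) \<longlonglongrightarrow> cmod c * 0" by (intro tendsto_intros h)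
  then show ?thesis using h by (simp add: NR_iff CS_cscale dst_cscale CS_D)
qed

lemma NR_adj: assumes "(x, x') \<in> NR" shows "((\<lambda>n. adj A (x n)), (\<lambda>n. adj A (x' n))) \<in> NR"
  using assms by (simp add: NR_iff CS_adj dst_adj CS_D)

abbreviation "H \<equiv> hausdorff_completion A p"

lemma UN_cl2:
  assumes "x \<in> CS" "y \<in> CS"
    and "\<And>x x' y y'. (x, x') \<in> NR \<Longrightarrow> (y, y') \<in> NR \<Longrightarrow> (f x y, f x' y') \<in> NR"
  shows "(\<Union>x' \<in> cl x. \<Union>y' \<in> cl y. NR `` {f x' y'}) = cl (f x y)"
  unfolding cl_def
proof (rule UN_equiv_class2[OF equiv_NR equiv_NR _ assms(1,2)])
  show "(\<lambda>x y. NR `` {f x y}) respects2 NR"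
    by (rule congruent2I') (use assms(3) equiv_class_eq[OF equiv_NR] in blast)
qed

lemma UN_cl1:
  assumes "x \<in> CS"
    and "\<And>x x'. (x, x') \<in> NR \<Longrightarrow> (f x, f x') \<in> NR"
  shows "(\<Union>x' \<in> cl x. NR `` {f x'}) = cl (f x)"
  unfolding cl_def
proof (rule UN_equiv_class[OF equiv_NR _ assms(1)])
  show "(\<lambda>x. NR `` {f x}) respects NR"
    by (rule congruentI) (use assms(2) equiv_class_eq[OF equiv_NR] in blast)
qed

lemma H_carrier: "carrier H = CS // NR"
  and H_one: "\<one>\<^bsub>H\<^esub> = cl (\<lambda>n. \<one>)" and H_zero: "\<zero>\<^bsub>H\<^esub> = cl (\<lambda>n. \<zero>)"
  by (simp_all add: hausdorff_completion_def cl_def)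

lemma H_mult: "x \<in> CS \<Longrightarrow> y \<in> CS \<Longrightarrow> cl x \<otimes>\<^bsub>H\<^esub> cl y = cl (\<lambda>n. x n \<otimes> y n)"
  by (simp add: hausdorff_completion_def) (rule UN_cl2; simp add: NR_mult)
lemma H_add: "x \<in> CS \<Longrightarrow> y \<in> CS \<Longrightarrow> cl x \<oplus>\<^bsub>H\<^esub> cl y = cl (\<lambda>n. x n \<oplus> y n)"
  by (simp add: hausdorff_completion_def) (rule UN_cl2; simp add: NR_add)
lemma H_cscale: "x \<in> CS \<Longrightarrow> cscale H c (cl x) = cl (\<lambda>n. cscale A c (x n))"
  by (simp add: hausdorff_completion_def) (rule UN_cl1; simp add: NR_cscale)
lemma H_adj: "x \<in> CS \<Longrightarrow> adj H (cl x) = cl (\<lambda>n. adj A (x n))"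
  by (simp add: hausdorff_completion_def) (rule UN_cl1; simp add: NR_adj)

lemma H_nrm_lim: assumes "x \<in> CS" shows "(\<lambda>n. p (x n)) \<longlonglongrightarrow> nrm H (cl x)"
proof -
  obtain l where l: "(\<lambda>n. p (x n)) \<longlonglongrightarrow> l" using p_conv[OF assms] by blast
  have all: "(\<lambda>n. p (y n)) \<longlonglongrightarrow> l" if "y \<in> cl x" for y
  proof -
    have h: "y \<in> CS" "(\<lambda>n. dst (x n) (y n)) \<longlonglongrightarrow> 0"
      using that in_cl[OF assms] by (simp_all add: NR_iff)
    have "(\<lambda>n. \<bar>p (x n) - p (y n)\<bar>) \<longlonglongrightarrow> 0"
      by (rule tendsto_0_le[OF h(2)]) (auto intro!: p_dst simp: CS_D h assms)
    then have "(\<lambda>n. p (x n) - p (y n)) \<longlonglongrightarrow> 0" by (simp add: tendsto_rabs_zero_iff)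
    from tendsto_diff[OF l this] show ?thesis by simp
  qed
  have x: "x \<in> cl x" using assms equiv_class_self[OF equiv_NR] by (simp add: cl_def)
  have "nrm H (cl x) = l"
    unfolding hausdorff_completion_def
    by simp (rule the_equality, use all in blast, use x l LIMSEQ_unique in blast)
  then show ?thesis using l by simp
qed

lemma H_nrm: "x \<in> CS \<Longrightarrow> (\<lambda>n. p (x n)) \<longlonglongrightarrow> l \<Longrightarrow> nrm H (cl x) = l"
  using H_nrm_lim LIMSEQ_unique by blast

lemmas CS_ops = CS_add CS_mult CS_cscale CS_adj CS_const
lemmas H_ops = H_add H_mult H_cscale H_adj H_one H_zero

lemma H_ring: "ring H"
proof (rule ringI)
  show "abelian_group H"
  proof (rule abelian_groupI)
    fix X Y Z assume "X \<in> carrier H" "Y \<in> carrier H" "Z \<in> carrier H"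
    then obtain x y z where e: "x \<in> CS" "X = cl x" "y \<in> CS" "Y = cl y" "z \<in> CS" "Z = cl z"
      unfolding H_carrier by (metis in_clE)
    show "X \<oplus>\<^bsub>H\<^esub> Y \<in> carrier H" using e by (simp add: H_ops CS_ops H_carrier cl_in)
    show "(X \<oplus>\<^bsub>H\<^esub> Y) \<oplus>\<^bsub>H\<^esub> Z = X \<oplus>\<^bsub>H\<^esub> (Y \<oplus>\<^bsub>H\<^esub> Z)"
      using e by (simp add: H_ops CS_ops CS_D a_assoc)
    show "X \<oplus>\<^bsub>H\<^esub> Y = Y \<oplus>\<^bsub>H\<^esub> X" using e by (simp add: H_ops CS_ops CS_D a_comm)
    show "\<zero>\<^bsub>H\<^esub> \<oplus>\<^bsub>H\<^esub> X = X" using e by (simp add: H_ops CS_ops CS_D)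
    show "\<exists>Y\<in>carrier H. Y \<oplus>\<^bsub>H\<^esub> X = \<zero>\<^bsub>H\<^esub>"
    proof
      show "cl (\<lambda>n. cscale A (-1) (x n)) \<in> carrier H" using e by (simp add: CS_ops H_carrier cl_in)
      show "cl (\<lambda>n. cscale A (-1) (x n)) \<oplus>\<^bsub>H\<^esub> X = \<zero>\<^bsub>H\<^esub>"
        using e by (simp add: H_ops CS_ops) (simp add: cscale_m1 CS_D l_neg)
    qed
  next
    show "\<zero>\<^bsub>H\<^esub> \<in> carrier H" by (simp add: H_ops CS_ops H_carrier cl_in)
  qed
  show "monoid H"
  proof (rule monoidI)
    fix X Y Z assume "X \<in> carrier H" "Y \<in> carrier H" "Z \<in> carrier H"
    then obtain x y z where e: "x \<in> CS" "X = cl x" "y \<in> CS" "Y = cl y" "z \<in> CS" "Z = cl z"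
      unfolding H_carrier by (metis in_clE)
    show "X \<otimes>\<^bsub>H\<^esub> Y \<in> carrier H" using e by (simp add: H_ops CS_ops H_carrier cl_in)
    show "(X \<otimes>\<^bsub>H\<^esub> Y) \<otimes>\<^bsub>H\<^esub> Z = X \<otimes>\<^bsub>H\<^esub> (Y \<otimes>\<^bsub>H\<^esub> Z)"
      using e by (simp add: H_ops CS_ops CS_D m_assoc)
    show "\<one>\<^bsub>H\<^esub> \<otimes>\<^bsub>H\<^esub> X = X" "X \<otimes>\<^bsub>H\<^esub> \<one>\<^bsub>H\<^esub> = X" using e by (simp_all add: H_ops CS_ops CS_D)
  next
    show "\<one>\<^bsub>H\<^esub> \<in> carrier H" by (simp add: H_ops CS_ops H_carrier cl_in)
  qed
  fix X Y Z assume "X \<in> carrier H" "Y \<in> carrier H" "Z \<in> carrier H"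
  then obtain x y z where e: "x \<in> CS" "X = cl x" "y \<in> CS" "Y = cl y" "z \<in> CS" "Z = cl z"
    unfolding H_carrier by (metis in_clE)
  show "(X \<oplus>\<^bsub>H\<^esub> Y) \<otimes>\<^bsub>H\<^esub> Z = X \<otimes>\<^bsub>H\<^esub> Z \<oplus>\<^bsub>H\<^esub> Y \<otimes>\<^bsub>H\<^esub> Z"
    "Z \<otimes>\<^bsub>H\<^esub> (X \<oplus>\<^bsub>H\<^esub> Y) = Z \<otimes>\<^bsub>H\<^esub> X \<oplus>\<^bsub>H\<^esub> Z \<otimes>\<^bsub>H\<^esub> Y"
    using e by (simp_all add: H_ops CS_ops CS_D l_distr r_distr)
qed

lemma H_normed: "normed_star_algebra H"
proof (intro normed_star_algebra.intro H_ring normed_star_algebra_axioms.intro)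
  fix X Y c d assume "X \<in> carrier H"
  then obtain x where x: "x \<in> CS" "X = cl x" unfolding H_carrier by (metis in_clE)
  show "cscale H c X \<in> carrier H" "adj H X \<in> carrier H"
    using x by (simp_all add: H_ops CS_ops H_carrier cl_in)
  show "cscale H (c + d) X = cscale H c X \<oplus>\<^bsub>H\<^esub> cscale H d X" "cscale H c (cscale H d X) = cscale H (c * d) X"
    "cscale H 1 X = X" "adj H (cscale H c X) = cscale H (cnj c) (adj H X)" "adj H (adj H X) = X"
    using x by (simp_all add: H_ops CS_ops CS_D add_cscale cscale_cscale cscale_one adj_cscale adj_adj)
  have l: "(\<lambda>n. p (x n)) \<longlonglongrightarrow> nrm H X" using H_nrm_lim x by simp
  show "0 \<le> nrm H X" by (rule LIMSEQ_le_const[OF l]) (use p_nonneg CS_D x in auto)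
  show "nrm H (cscale H c X) = cmod c * nrm H X"
    using x tendsto_mult_left[OF l, of "cmod c"] by (simp add: H_ops) (rule H_nrm, auto simp: CS_ops p_cscale CS_D)
  show "nrm H (adj H X) = nrm H X"
    using x l by (simp add: H_ops) (rule H_nrm, auto simp: CS_ops p_adj CS_D)
  have "nrm H X = 0 \<longleftrightarrow> (\<lambda>n. p (x n)) \<longlonglongrightarrow> 0" using l LIMSEQ_unique by auto
  also have "\<dots> \<longleftrightarrow> X = \<zero>\<^bsub>H\<^esub>"
    using x by (simp add: H_ops cl_eq_iff CS_ops NR_iff dst_def a_minus_def CS_D)
  finally show "nrm H X = 0 \<longleftrightarrow> X = \<zero>\<^bsub>H\<^esub>" .
  assume "Y \<in> carrier H"
  then obtain y where y: "y \<in> CS" "Y = cl y" unfolding H_carrier by (metis in_clE)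
  show "cscale H c (X \<oplus>\<^bsub>H\<^esub> Y) = cscale H c X \<oplus>\<^bsub>H\<^esub> cscale H c Y"
    "cscale H c X \<otimes>\<^bsub>H\<^esub> Y = cscale H c (X \<otimes>\<^bsub>H\<^esub> Y)"
    "X \<otimes>\<^bsub>H\<^esub> cscale H c Y = cscale H c (X \<otimes>\<^bsub>H\<^esub> Y)"
    "adj H (X \<oplus>\<^bsub>H\<^esub> Y) = adj H X \<oplus>\<^bsub>H\<^esub> adj H Y"
    "adj H (X \<otimes>\<^bsub>H\<^esub> Y) = adj H Y \<otimes>\<^bsub>H\<^esub> adj H X"
    using x y by (simp_all add: H_ops CS_ops CS_D cscale_add cscale_mult_left cscale_mult_right adj_add adj_mult)
  have l': "(\<lambda>n. p (y n)) \<longlonglongrightarrow> nrm H Y" using H_nrm_lim y by simp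
  have "(\<lambda>n. p (x n \<oplus> y n)) \<longlonglongrightarrow> nrm H (X \<oplus>\<^bsub>H\<^esub> Y)" "(\<lambda>n. p (x n \<otimes> y n)) \<longlonglongrightarrow> nrm H (X \<otimes>\<^bsub>H\<^esub> Y)"
    using x y by (simp_all add: H_ops H_nrm_lim CS_ops)
  note xy = this
  show "nrm H (X \<oplus>\<^bsub>H\<^esub> Y) \<le> nrm H X + nrm H Y"
    by (rule LIMSEQ_le[OF xy(1) tendsto_add[OF l l']]) (use x y in \<open>simp add: p_add CS_D\<close>)
  show "nrm H (X \<otimes>\<^bsub>H\<^esub> Y) \<le> nrm H X * nrm H Y"
    by (rule LIMSEQ_le[OF xy(2) tendsto_mult[OF l l']]) (use x y in \<open>simp add: p_mult CS_D\<close>)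
qed

lemma H_minus: assumes "x \<in> CS" "y \<in> CS" shows "cl x \<ominus>\<^bsub>H\<^esub> cl y = cl (\<lambda>n. x n \<ominus> y n)"
proof -
  have "\<ominus>\<^bsub>H\<^esub> cl y = cscale H (-1) (cl y)"
    using normed_star_algebra.cscale_m1[OF H_normed] assms H_carrier cl_in by metis
  then show ?thesis using assms
    by (simp add: a_minus_def H_ops CS_ops) (simp add: cscale_m1 CS_D)
qed

lemma H_dense: assumes "x \<in> CS" and "e > 0"
  shows "\<exists>N. \<forall>n \<ge> N. nrm H (cl x \<ominus>\<^bsub>H\<^esub> cl (\<lambda>_. x n)) < e"
proof -
  obtain N where N: "\<forall>m \<ge> N. \<forall>n \<ge> N. dst (x m) (x n) < e / 2"
    using assms unfolding CS_iff by (meson half_gt_zero)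
  have "nrm H (cl x \<ominus>\<^bsub>H\<^esub> cl (\<lambda>_. x n)) < e" if "n \<ge> N" for n
  proof -
    have "(\<lambda>_. x n) \<in> CS" using CS_ops CS_D assms by simp
    moreover have "(\<lambda>m. x m \<ominus> x n) \<in> CS"
    proof -
      have "(\<lambda>m. x m \<oplus> cscale A (-1) (x n)) \<in> CS"
        using assms by (intro CS_add CS_const cscale_closed) (auto simp: CS_D)
      then show ?thesis using assms by (simp add: a_minus_def cscale_m1 CS_D)
    qed
    ultimately have "(\<lambda>m. p (x m \<ominus> x n)) \<longlonglongrightarrow> nrm H (cl x \<ominus>\<^bsub>H\<^esub> cl (\<lambda>_. x n))"
      using assms by (simp add: H_minus H_nrm_lim)
    moreover have "\<forall>m\<ge>N. p (x m \<ominus> x n) \<le> e/2" using N that by (auto simp: dst_def less_imp_le)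
    ultimately have "nrm H (cl x \<ominus>\<^bsub>H\<^esub> cl (\<lambda>_. x n)) \<le> e/2" by (intro LIMSEQ_le_const2) auto
    then show ?thesis using assms by simp
  qed
  then show ?thesis by blast
qed


lemma H_const_dst: assumes "a \<in> carrier A" "b \<in> carrier A"
  shows "nrm H (cl (\<lambda>_. a) \<ominus>\<^bsub>H\<^esub> cl (\<lambda>_. b)) = dst a b"
  using assms by (simp add: H_minus CS_const dst_def) (rule H_nrm, auto intro: CS_const)

lemma H_cstar_identity: assumes "X \<in> carrier H" shows "nrm H (adj H X \<otimes>\<^bsub>H\<^esub> X) = (nrm H X)\<^sup>2"
proof -
  obtain x where x: "x \<in> CS" "X = cl x" using assms unfolding H_carrier by (metis in_clE)
  have l: "(\<lambda>n. p (x n)) \<longlonglongrightarrow> nrm H X" using H_nrm_lim x by simp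
  have "(\<lambda>n. p (adj A (x n) \<otimes> x n)) \<longlonglongrightarrow> (nrm H X)\<^sup>2"
    using tendsto_power[OF l, of 2] x by (simp add: p_cstar CS_D)
  then show ?thesis using x by (simp add: H_ops CS_ops H_nrm)
qed

lemma H_seminormed: "cstar_seminormed H (nrm H)"
proof -
  interpret h: normed_star_algebra H by (rule H_normed)
  show ?thesis
    by unfold_locales
      (simp add: cstar_seminorm_def h.nrm_nonneg h.nrm_triangle h.nrm_cscale h.nrm_mult H_cstar_identity)
qed

theorem hausdorff_completion_cstar: "cstar_algebra H"
proof -
  interpret h: cstar_seminormed H "nrm H" by (rule H_seminormed)
  show ?thesis
  proof (intro cstar_algebra.intro H_normed cstar_algebra_axioms.intro)
    show "nrm H (adj H X \<otimes>\<^bsub>H\<^esub> X) = (nrm H X)\<^sup>2" if "X \<in> carrier H" for X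
      using that by (rule H_cstar_identity)
    fix X assume "X \<in> cauchy_seqs H (nrm H)"
    then have XC: "\<And>n. X n \<in> carrier H"
      and Xc: "\<And>e. 0 < e \<Longrightarrow> \<exists>N. \<forall>m \<ge> N. \<forall>n \<ge> N. h.dst (X m) (X n) < e"
      unfolding h.CS_iff by auto
    have "\<exists>a. a \<in> carrier A \<and> h.dst (X n) (cl (\<lambda>_. a)) < inverse (real (Suc n))" for n
    proof -
      obtain x where x: "x \<in> CS" "X n = cl x" using XC[of n] unfolding H_carrier by (metis in_clE)
      obtain N where "\<forall>k \<ge> N. nrm H (cl x \<ominus>\<^bsub>H\<^esub> cl (\<lambda>_. x k)) < inverse (real (Suc n))"
        using H_dense[OF x(1), of "inverse (real (Suc n))"] by auto
      then show ?thesis using x by (intro exI[of _ "x N"]) (simp add: h.dst_def CS_D)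
    qed
    then obtain y where y: "\<And>n. y n \<in> carrier A" "\<And>n. h.dst (X n) (cl (\<lambda>_. y n)) < inverse (real (Suc n))"
      by metis
    define Y where "Y n = cl (\<lambda>_. y n)" for n
    have YC: "Y n \<in> carrier H" for n using y(1) by (simp add: Y_def H_carrier cl_in CS_const)
    have XY: "(\<lambda>n. h.dst (X n) (Y n)) \<longlonglongrightarrow> 0"
      by (rule tendsto_0_le[OF LIMSEQ_inverse_real_of_nat])
        (use y h.dst_nonneg XC YC in \<open>auto simp: Y_def less_imp_le\<close>)
    have yC: "y \<in> CS"
      unfolding CS_iff
    proof (intro conjI allI impI)
      show "y n \<in> carrier A" for n by (rule y)
      fix e :: real assume "e > 0"
      then have e3: "e/3 > 0" by simp
      obtain N where N: "\<forall>m \<ge> N. \<forall>n \<ge> N. h.dst (X m) (X n) < e/3" using Xc[OF e3] by blast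
      obtain M where M: "\<forall>n \<ge> M. h.dst (X n) (Y n) < e/3"
        using order_tendstoD(2)[OF XY e3] by (auto simp: eventually_sequentially)
      show "\<exists>N. \<forall>m \<ge> N. \<forall>n \<ge> N. dst (y m) (y n) < e"
      proof (intro exI[of _ "max N M"] allI impI)
        fix m n assume "max N M \<le> m" "max N M \<le> n"
        then have "h.dst (X m) (X n) < e/3" "h.dst (X m) (Y m) < e/3" "h.dst (X n) (Y n) < e/3"
          using N M by auto
        moreover have "dst (y m) (y n) = h.dst (Y m) (Y n)"
          using H_const_dst[OF y(1) y(1)] by (simp add: h.dst_def Y_def)
        moreover have "h.dst (Y m) (Y n) \<le> h.dst (Y m) (X m) + h.dst (X m) (Y n)"
          "h.dst (X m) (Y n) \<le> h.dst (X m) (X n) + h.dst (X n) (Y n)"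
          by (intro h.dst_triangle XC YC)+
        moreover have "h.dst (Y m) (X m) = h.dst (X m) (Y m)" by (intro h.dst_sym XC YC)
        ultimately show "dst (y m) (y n) < e" by linarith
      qed
    qed
    have clyC: "cl y \<in> carrier H" using yC by (simp add: H_carrier cl_in)
    have Yy: "(\<lambda>n. h.dst (Y n) (cl y)) \<longlonglongrightarrow> 0"
    proof (rule LIMSEQ_I)
      fix e :: real assume "e > 0"
      from H_dense[OF yC this] obtain N where N: "\<forall>n\<ge>N. h.dst (cl y) (Y n) < e"
        by (auto simp: h.dst_def Y_def)
      then show "\<exists>N. \<forall>n\<ge>N. norm (h.dst (Y n) (cl y) - 0) < e"
        using h.dst_sym[OF YC clyC] h.dst_nonneg[OF YC clyC] by auto
    qed
    have "(\<lambda>n. h.dst (X n) (Y n) + h.dst (Y n) (cl y)) \<longlonglongrightarrow> 0" using tendsto_add[OF XY Yy] by simp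
    then have "(\<lambda>n. h.dst (X n) (cl y)) \<longlonglongrightarrow> 0"
      by (rule tendsto_0_le) (auto intro!: h.dst_nonneg h.dst_triangle XC YC clyC)
    then show "\<exists>a\<in>carrier H. (\<lambda>n. nrm H (X n \<ominus>\<^bsub>H\<^esub> a)) \<longlonglongrightarrow> 0"
      using clyC by (auto simp: h.dst_def)
  qed
qed

end

context normed_star_algebra
begin

lemma zero_cstar_seminorm: "cstar_seminorm A (\<lambda>_. 0)"
  by (simp add: cstar_seminorm_def nrm_nonneg)

abbreviation "U \<equiv> enveloping_seminorm A"

lemma le_U: assumes "cstar_seminorm A p" "a \<in> carrier A" shows "p a \<le> U a"
  unfolding enveloping_seminorm_def
proof (rule cSUP_upper)
  show "p \<in> {p. cstar_seminorm A p}" using assms by simp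
  show "bdd_above ((\<lambda>p. p a) ` {p. cstar_seminorm A p})"
    by (rule bdd_aboveI[of _ "nrm A a"]) (use assms in \<open>auto simp: cstar_seminorm_def\<close>)
qed

lemma U_le: "(\<And>p. cstar_seminorm A p \<Longrightarrow> p a \<le> c) \<Longrightarrow> U a \<le> c"
  unfolding enveloping_seminorm_def using zero_cstar_seminorm by (intro cSUP_least) auto

lemma U_nonneg: "a \<in> carrier A \<Longrightarrow> 0 \<le> U a"
  using le_U[OF zero_cstar_seminorm] by simp

lemma enveloping_seminormed: "cstar_seminormed A U"
proof unfold_locales
  have sc: "U (cscale A c a) \<le> cmod c * U a" if a: "a \<in> carrier A" for a c
  proof (rule U_le)
    fix p assume p: "cstar_seminorm A p"
    then have "p (cscale A c a) = cmod c * p a" using a by (simp add: cstar_seminorm_def)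
    then show "p (cscale A c a) \<le> cmod c * U a" using le_U[OF p a] by (simp add: mult_left_mono)
  qed
  show "cstar_seminorm A U"
    unfolding cstar_seminorm_def
  proof (intro conjI ballI allI)
    fix a c assume a: "a \<in> carrier A"
    show "0 \<le> U a" using a by (rule U_nonneg)
    show "U a \<le> nrm A a" by (rule U_le) (use a in \<open>auto simp: cstar_seminorm_def\<close>)
    show "U (cscale A c a) = cmod c * U a"
    proof (cases "c = 0")
      case True
      then show ?thesis using sc[OF a, of 0] U_nonneg[OF cscale_closed[OF a, of 0]] by simp
    next
      case False
      have "U a \<le> cmod (inverse c) * U (cscale A c a)"
        using sc[OF cscale_closed[OF a], of "inverse c" c] False by (simp add: cscale_cscale a cscale_one)
      then have "cmod c * U a \<le> U (cscale A c a)"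
        using False by (simp add: norm_inverse inverse_eq_divide norm_divide pos_le_divide_eq mult.commute)
      then show ?thesis using sc[OF a, of c] by simp
    qed
    show "U (adj A a \<otimes> a) = (U a)\<^sup>2"
    proof (rule antisym)
      show "U (adj A a \<otimes> a) \<le> (U a)\<^sup>2"
      proof (rule U_le)
        fix p assume p: "cstar_seminorm A p"
        then have "p (adj A a \<otimes> a) = (p a)\<^sup>2" "0 \<le> p a" using a by (simp_all add: cstar_seminorm_def)
        then show "p (adj A a \<otimes> a) \<le> (U a)\<^sup>2" using le_U[OF p a] by (simp add: power_mono)
      qed
      have aa: "adj A a \<otimes> a \<in> carrier A" using a adj_closed by simp
      have "U a \<le> sqrt (U (adj A a \<otimes> a))"
      proof (rule U_le)
        fix p assume p: "cstar_seminorm A p"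
        then have "p (adj A a \<otimes> a) = (p a)\<^sup>2" "0 \<le> p a" using a by (simp_all add: cstar_seminorm_def)
        then show "p a \<le> sqrt (U (adj A a \<otimes> a))" using le_U[OF p aa] by (simp add: real_le_rsqrt)
      qed
      then have "(U a)\<^sup>2 \<le> (sqrt (U (adj A a \<otimes> a)))\<^sup>2" using U_nonneg[OF a] by (rule power_mono)
      then show "(U a)\<^sup>2 \<le> U (adj A a \<otimes> a)" using U_nonneg[OF aa] by simp
    qed
  next
    fix a b assume a: "a \<in> carrier A" and b: "b \<in> carrier A"
    show "U (a \<oplus> b) \<le> U a + U b"
    proof (rule U_le)
      fix p assume p: "cstar_seminorm A p"
      then have "p (a \<oplus> b) \<le> p a + p b" using a b by (simp add: cstar_seminorm_def)
      then show "p (a \<oplus> b) \<le> U a + U b" using le_U[OF p a] le_U[OF p b] by simp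
    qed
    show "U (a \<otimes> b) \<le> U a * U b"
    proof (rule U_le)
      fix p assume p: "cstar_seminorm A p"
      then have "p (a \<otimes> b) \<le> p a * p b" "0 \<le> p b" using a b by (simp_all add: cstar_seminorm_def)
      then show "p (a \<otimes> b) \<le> U a * U b"
        using mult_mono[OF le_U[OF p a] le_U[OF p b] U_nonneg[OF a]] by linarith
    qed
  qed
qed

theorem enveloping_cstar_algebra: "cstar_algebra (enveloping_cstar A)"
  unfolding enveloping_cstar_def by (rule cstar_seminormed.hausdorff_completion_cstar[OF enveloping_seminormed])

end

text \<open>Every contractive *-homomorphism into a C*-algebra factors through the enveloping C*-algebra.\<close>

theorem enveloping_cstar_universal:
  assumes "normed_star_algebra A" and "cstar_algebra B"
    and \<pi>: "\<pi> \<in> star_hom A B" and contr: "\<And>a. a \<in> carrier A \<Longrightarrow> nrm B (\<pi> a) \<le> nrm A a"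
  shows "\<exists>\<sigma> \<in> star_hom (enveloping_cstar A) B. \<forall>a \<in> carrier A. \<sigma> (enveloping_map A a) = \<pi> a"
proof -
  interpret A: normed_star_algebra A by fact
  interpret B: cstar_algebra B by fact
  interpret u: cstar_seminormed A "enveloping_seminorm A" by (rule A.enveloping_seminormed)
  interpret b: cstar_seminormed B "nrm B"
    by unfold_locales (simp add: cstar_seminorm_def B.nrm_nonneg B.nrm_triangle B.nrm_cscale B.nrm_mult B.cstar_identity)
  have \<pi>C: "\<pi> a \<in> carrier B" if "a \<in> carrier A" for a using \<pi> that by (auto simp: star_hom_def)
  have \<pi>h: "\<pi> (a \<oplus>\<^bsub>A\<^esub> b) = \<pi> a \<oplus>\<^bsub>B\<^esub> \<pi> b" "\<pi> (a \<otimes>\<^bsub>A\<^esub> b) = \<pi> a \<otimes>\<^bsub>B\<^esub> \<pi> b"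
    "\<pi> (cscale A c a) = cscale B c (\<pi> a)" "\<pi> (adj A a) = adj B (\<pi> a)"
    if "a \<in> carrier A" "b \<in> carrier A" for a b c using \<pi> that by (auto simp: star_hom_def)
  have sn: "cstar_seminorm A (\<lambda>a. nrm B (\<pi> a))"
    by (simp add: cstar_seminorm_def contr \<pi>h \<pi>C B.nrm_nonneg B.nrm_triangle B.nrm_cscale B.nrm_mult B.cstar_identity A.adj_closed)
  have \<pi>m: "\<pi> (a \<ominus>\<^bsub>A\<^esub> b) = \<pi> a \<ominus>\<^bsub>B\<^esub> \<pi> b" if "a \<in> carrier A" "b \<in> carrier A" for a b
    using that A.cscale_closed[of b "-1"] 
    by (simp add: a_minus_def A.cscale_m1[symmetric] B.cscale_m1[symmetric] \<pi>h \<pi>C)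
  have d: "b.dst (\<pi> a) (\<pi> b) \<le> u.dst a b" if "a \<in> carrier A" "b \<in> carrier A" for a b
    using A.le_U[OF sn, of "a \<ominus>\<^bsub>A\<^esub> b"] that by (simp add: b.dst_def u.dst_def \<pi>m)
  have \<pi>CS: "(\<lambda>n. \<pi> (x n)) \<in> b.CS" if x: "x \<in> u.CS" for x
    unfolding b.CS_iff
  proof (intro conjI allI impI)
    show "\<pi> (x n) \<in> carrier B" for n using \<pi>C u.CS_D[OF x] by simp
    fix e :: real assume "e > 0"
    then obtain N where "\<forall>m\<ge>N. \<forall>n\<ge>N. u.dst (x m) (x n) < e" using x unfolding u.CS_iff by blast
    then show "\<exists>N. \<forall>m\<ge>N. \<forall>n\<ge>N. b.dst (\<pi> (x m)) (\<pi> (x n)) < e"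
      using d u.CS_D[OF x] by (meson le_less_trans)
  qed
  have bcl: "b.cl y = b.cl (\<lambda>_. c) \<longleftrightarrow> (\<lambda>n. b.dst (y n) c) \<longlonglongrightarrow> 0" if "y \<in> b.CS" "c \<in> carrier B" for y c
    using that by (simp add: b.cl_eq_iff b.CS_const b.NR_iff)
  have inj: "c = c'" if "b.cl (\<lambda>_. c) = b.cl (\<lambda>_. c')" "c \<in> carrier B" "c' \<in> carrier B" for c c'
  proof -
    have "(\<lambda>n::nat. b.dst c c') \<longlonglongrightarrow> 0" using that bcl[OF b.CS_const] by simp
    then have "b.dst c c' = 0" using LIMSEQ_unique tendsto_const by blast
    then have "c \<ominus>\<^bsub>B\<^esub> c' = \<zero>\<^bsub>B\<^esub>" using that B.nrm_eq_0 by (simp add: b.dst_def)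
    moreover have "(c \<ominus>\<^bsub>B\<^esub> c') \<oplus>\<^bsub>B\<^esub> c' = c"
      using that by (simp add: a_minus_def B.a_assoc B.l_neg)
    ultimately show ?thesis using that by simp
  qed
  have ex: "\<exists>c \<in> carrier B. b.cl y = b.cl (\<lambda>_. c)" if y: "y \<in> b.CS" for y
    using B.complete[OF y] bcl[OF y] by (auto simp: b.dst_def)
  define L where "L y = (SOME c. c \<in> carrier B \<and> b.cl y = b.cl (\<lambda>_. c))" for y
  have L: "L y \<in> carrier B" "b.cl y = b.cl (\<lambda>_. L y)" if "y \<in> b.CS" for y
    using someI_ex[of "\<lambda>c. c \<in> carrier B \<and> b.cl y = b.cl (\<lambda>_. c)"] ex[OF that] unfolding L_def by blast+
  have L_eq: "L y = c" if "y \<in> b.CS" "c \<in> carrier B" "b.cl y = b.cl (\<lambda>_. c)" for y c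
    using inj[of "L y" c] L[OF that(1)] that by simp
  have Lcong: "L y = L y'" if "b.cl y = b.cl y'" for y y' using that by (simp add: L_def)
  define \<sigma> where "\<sigma> X = L (\<lambda>n. \<pi> ((SOME x. x \<in> u.CS \<and> X = u.cl x) n))" for X
  have \<sigma>: "\<sigma> (u.cl x) = L (\<lambda>n. \<pi> (x n))" if x: "x \<in> u.CS" for x
  proof -
    define x' where "x' = (SOME x'. x' \<in> u.CS \<and> u.cl x = u.cl x')"
    have x': "x' \<in> u.CS" "u.cl x = u.cl x'"
      using someI_ex[of "\<lambda>x'. x' \<in> u.CS \<and> u.cl x = u.cl x'"] x unfolding x'_def by blast+
    then have *: "(\<lambda>n. u.dst (x' n) (x n)) \<longlonglongrightarrow> 0" using x by (metis u.cl_eq_iff u.NR_iff)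
    have "(\<lambda>n. b.dst (\<pi> (x' n)) (\<pi> (x n))) \<longlonglongrightarrow> 0"
      by (rule u.tendsto_0_le[OF *]) (auto intro!: b.dst_nonneg d \<pi>C simp: u.CS_D x x')
    then have "b.cl (\<lambda>n. \<pi> (x' n)) = b.cl (\<lambda>n. \<pi> (x n))"
      using x x' \<pi>CS by (simp add: b.cl_eq_iff b.NR_iff)
    then show ?thesis unfolding \<sigma>_def x'_def[symmetric] by (rule Lcong)
  qed
  have H: "enveloping_cstar A = u.H" by (simp add: enveloping_cstar_def)
  have "\<sigma> \<in> star_hom (enveloping_cstar A) B"
    unfolding star_hom_def H
  proof (intro CollectI conjI ballI allI funcsetI)
    fix X c assume "X \<in> carrier u.H"
    then obtain x where x: "x \<in> u.CS" "X = u.cl x" unfolding u.H_carrier by (metis u.in_clE)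
    show "\<sigma> X \<in> carrier B" using x \<pi>CS by (simp add: \<sigma> L)
    note LX = L[OF \<pi>CS[OF x(1)]]
    have "b.cl (\<lambda>n. \<pi> (cscale A c (x n))) = b.cl (\<lambda>_. cscale B c (L (\<lambda>n. \<pi> (x n))))"
      using b.H_cscale[OF \<pi>CS[OF x(1)], of c] b.H_cscale[OF b.CS_const[OF LX(1)], of c] LX(2) x
      by (simp add: \<pi>h[OF u.CS_D u.CS_D])
    then show "\<sigma> (cscale u.H c X) = cscale B c (\<sigma> X)"
      using x LX by (simp add: u.H_cscale \<sigma> u.CS_cscale) (intro L_eq \<pi>CS u.CS_cscale B.cscale_closed)
    have "b.cl (\<lambda>n. \<pi> (adj A (x n))) = b.cl (\<lambda>_. adj B (L (\<lambda>n. \<pi> (x n))))"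
      using b.H_adj[OF \<pi>CS[OF x(1)]] b.H_adj[OF b.CS_const[OF LX(1)]] LX(2) x
      by (simp add: \<pi>h[OF u.CS_D u.CS_D])
    then show "\<sigma> (adj u.H X) = adj B (\<sigma> X)"
      using x LX by (simp add: u.H_adj \<sigma> u.CS_adj) (intro L_eq \<pi>CS u.CS_adj B.adj_closed)
  next
    fix X Y assume "X \<in> carrier u.H" "Y \<in> carrier u.H"
    then obtain x y where x: "x \<in> u.CS" "X = u.cl x" and y: "y \<in> u.CS" "Y = u.cl y"
      unfolding u.H_carrier by (metis u.in_clE)
    note LX = L[OF \<pi>CS[OF x(1)]] note LY = L[OF \<pi>CS[OF y(1)]]
    have "b.cl (\<lambda>n. \<pi> (x n \<oplus>\<^bsub>A\<^esub> y n)) = b.cl (\<lambda>_. L (\<lambda>n. \<pi> (x n)) \<oplus>\<^bsub>B\<^esub> L (\<lambda>n. \<pi> (y n)))"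
      using b.H_add[OF \<pi>CS[OF x(1)] \<pi>CS[OF y(1)]] b.H_add[OF b.CS_const[OF LX(1)] b.CS_const[OF LY(1)]] LX(2) LY(2) x y
      by (simp add: \<pi>h[OF u.CS_D u.CS_D])
    then show "\<sigma> (X \<oplus>\<^bsub>u.H\<^esub> Y) = \<sigma> X \<oplus>\<^bsub>B\<^esub> \<sigma> Y"
      using x y LX LY by (simp add: u.H_add \<sigma> u.CS_add) (intro L_eq \<pi>CS u.CS_add B.add.m_closed)
    have "b.cl (\<lambda>n. \<pi> (x n \<otimes>\<^bsub>A\<^esub> y n)) = b.cl (\<lambda>_. L (\<lambda>n. \<pi> (x n)) \<otimes>\<^bsub>B\<^esub> L (\<lambda>n. \<pi> (y n)))"
      using b.H_mult[OF \<pi>CS[OF x(1)] \<pi>CS[OF y(1)]] b.H_mult[OF b.CS_const[OF LX(1)] b.CS_const[OF LY(1)]] LX(2) LY(2) x y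
      by (simp add: \<pi>h[OF u.CS_D u.CS_D])
    then show "\<sigma> (X \<otimes>\<^bsub>u.H\<^esub> Y) = \<sigma> X \<otimes>\<^bsub>B\<^esub> \<sigma> Y"
      using x y LX LY by (simp add: u.H_mult \<sigma> u.CS_mult) (intro L_eq \<pi>CS u.CS_mult B.m_closed)
  qed
  moreover have "\<sigma> (enveloping_map A a) = \<pi> a" if a: "a \<in> carrier A" for a
  proof -
    have "enveloping_map A a = u.cl (\<lambda>n. a)" by (simp add: enveloping_map_def u.cl_def)
    then show ?thesis using a \<sigma>[OF u.CS_const[OF a]]
      by (simp add: L_eq[OF \<pi>CS[OF u.CS_const[OF a]] \<pi>C[OF a]])
  qed
  ultimately show ?thesis by blast
qed

subsection \<open>Convolution algebras\<close>

lemma abs_summable_subset: "f abs_summable_on A \<Longrightarrow> B \<subseteq> A \<Longrightarrow> f abs_summable_on B"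
  using summable_on_subset_banach by blast

lemma abs_summable_prod:
  fixes a b :: "_ \<Rightarrow> complex"
  assumes a: "a abs_summable_on C" and b: "b abs_summable_on D"
  shows "(\<lambda>(s, t). a s * b t) abs_summable_on C \<times> D"
    and "(\<Sum>\<^sub>\<infinity>(s, t) \<in> C \<times> D. norm (a s * b t)) = (\<Sum>\<^sub>\<infinity>s \<in> C. norm (a s)) * (\<Sum>\<^sub>\<infinity>t \<in> D. norm (b t))"
proof -
  have 1: "(\<lambda>s. \<Sum>\<^sub>\<infinity>t\<in>D. norm (a s * b t)) = (\<lambda>s. norm (a s) * (\<Sum>\<^sub>\<infinity>t\<in>D. norm (b t)))"
    by (simp add: norm_mult infsum_cmult_right')
  show s: "(\<lambda>(s, t). a s * b t) abs_summable_on C \<times> D"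
    unfolding abs_summable_on_Sigma_iff
    using summable_on_cmult_right[OF b, of "norm (a _)"] summable_on_cmult_left[OF a] 1
    by (auto simp: norm_mult infsum_cmult_right' abs_mult infsum_nonneg intro!: summable_on_cmult_right[OF b] summable_on_cmult_left[OF a])
  have "(\<Sum>\<^sub>\<infinity>(s, t) \<in> C \<times> D. norm (a s * b t)) = (\<Sum>\<^sub>\<infinity>s\<in>C. \<Sum>\<^sub>\<infinity>t\<in>D. norm (a s * b t))"
    using infsum_Sigma'_banach[of "\<lambda>s t. norm (a s * b t)" C "\<lambda>_. D"] s
    by (simp add: case_prod_unfold)
  then show "(\<Sum>\<^sub>\<infinity>(s, t) \<in> C \<times> D. norm (a s * b t)) = (\<Sum>\<^sub>\<infinity>s \<in> C. norm (a s)) * (\<Sum>\<^sub>\<infinity>t \<in> D. norm (b t))"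
    by (simp add: 1 infsum_cmult_left')
qed

lemma push_forward:
  fixes F :: "'x \<Rightarrow> complex"
  assumes F: "F abs_summable_on X" and f: "\<And>x. x \<in> X \<Longrightarrow> f x \<in> Y"
  shows "(\<lambda>r. infsum F {x \<in> X. f x = r}) abs_summable_on Y"
    and "(\<Sum>\<^sub>\<infinity>r\<in>Y. norm (infsum F {x \<in> X. f x = r})) \<le> (\<Sum>\<^sub>\<infinity>x\<in>X. norm (F x))"
proof -
  let ?fib = "\<lambda>r. {x \<in> X. f x = r}"
  have bij: "bij_betw snd (Sigma Y ?fib) X"
    by (rule bij_betwI[where g = "\<lambda>x. (f x, x)"]) (auto simp: f)
  have S: "(\<lambda>p. F (snd p)) abs_summable_on Sigma Y ?fib"
    using summable_on_reindex_bij_betw[OF bij, of "\<lambda>x. norm (F x)"] F by simp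
  then have S1: "\<And>r. r \<in> Y \<Longrightarrow> F abs_summable_on ?fib r"
    and S2: "(\<lambda>r. infsum (\<lambda>x. norm (F x)) (?fib r)) abs_summable_on Y"
    unfolding abs_summable_on_Sigma_iff by auto
  have S2': "(\<lambda>r. infsum (\<lambda>x. norm (F x)) (?fib r)) summable_on Y"
    using S2 by (simp add: infsum_nonneg)
  have le: "norm (infsum F (?fib r)) \<le> infsum (\<lambda>x. norm (F x)) (?fib r)" if "r \<in> Y" for r
    using S1[OF that] by (rule norm_infsum_bound)
  show 1: "(\<lambda>r. infsum F (?fib r)) abs_summable_on Y"
    by (rule abs_summable_on_comparison_test[OF S2]) (use le in \<open>auto intro: order_trans[OF _ abs_ge_self]\<close>)
  have "(\<Sum>\<^sub>\<infinity>r\<in>Y. norm (infsum F (?fib r))) \<le> (\<Sum>\<^sub>\<infinity>r\<in>Y. infsum (\<lambda>x. norm (F x)) (?fib r))"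
    by (rule infsum_mono[OF 1 S2' le])
  also have "\<dots> = infsum (\<lambda>p. norm (F (snd p))) (Sigma Y ?fib)"
    using infsum_Sigma_banach[of "\<lambda>p. norm (F (snd p))" Y ?fib] S by simp
  also have "\<dots> = (\<Sum>\<^sub>\<infinity>x\<in>X. norm (F x))"
    by (rule infsum_reindex_bij_betw[OF bij])
  finally show "(\<Sum>\<^sub>\<infinity>r\<in>Y. norm (infsum F (?fib r))) \<le> (\<Sum>\<^sub>\<infinity>x\<in>X. norm (F x))" .
qed

locale involutive_monoid = monoid P for P (structure) +
  fixes i :: "'a \<Rightarrow> 'a"
  assumes i_closed: "x \<in> carrier P \<Longrightarrow> i x \<in> carrier P"
    and i_i: "x \<in> carrier P \<Longrightarrow> i (i x) = x"
    and i_mult: "x \<in> carrier P \<Longrightarrow> y \<in> carrier P \<Longrightarrow> i (x \<otimes> y) = i y \<otimes> i x"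
begin

abbreviation "L \<equiv> l1_algebra P i"
abbreviation "fib r \<equiv> {(s, t). s \<in> carrier P \<and> t \<in> carrier P \<and> s \<otimes> t = r}"

lemma fib_eq: "fib r = {x \<in> carrier P \<times> carrier P. (case x of (s, t) \<Rightarrow> s \<otimes> t) = r}" by auto

lemma L_carrier: "a \<in> carrier L \<longleftrightarrow> a abs_summable_on carrier P \<and> (\<forall>r. r \<notin> carrier P \<longrightarrow> a r = 0)"
  by (simp add: l1_algebra_def)

lemma L_sum: "a \<in> carrier L \<Longrightarrow> a summable_on carrier P" using abs_summable_summable by (auto simp: L_carrier)

lemma L_mult: "(a \<otimes>\<^bsub>L\<^esub> b) r = (\<Sum>\<^sub>\<infinity>(s, t) \<in> fib r. a s * b t)"
  and L_one: "\<one>\<^bsub>L\<^esub> = (\<lambda>r. if r = \<one> then 1 else 0)"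
  and L_zero: "\<zero>\<^bsub>L\<^esub> = (\<lambda>r. 0)"
  and L_add: "a \<oplus>\<^bsub>L\<^esub> b = (\<lambda>r. a r + b r)"
  and L_cscale: "cscale L c a = (\<lambda>r. c * a r)"
  and L_adj: "adj L a = (\<lambda>r. if r \<in> carrier P then cnj (a (i r)) else 0)"
  and L_nrm: "nrm L a = (\<Sum>\<^sub>\<infinity>r \<in> carrier P. cmod (a r))"
  by (simp_all add: l1_algebra_def)

lemma prodsum: "a \<in> carrier L \<Longrightarrow> b \<in> carrier L \<Longrightarrow> (\<lambda>(s, t). a s * b t) abs_summable_on carrier P \<times> carrier P"
  by (simp add: L_carrier abs_summable_prod)

lemma fibsum: "a \<in> carrier L \<Longrightarrow> b \<in> carrier L \<Longrightarrow> (\<lambda>(s, t). a s * b t) summable_on fib r"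
  by (rule abs_summable_summable, rule abs_summable_subset[OF prodsum]) auto

lemma L_mult_closed: assumes "a \<in> carrier L" "b \<in> carrier L" shows "a \<otimes>\<^bsub>L\<^esub> b \<in> carrier L"
proof -
  have "(a \<otimes>\<^bsub>L\<^esub> b) abs_summable_on carrier P"
    using push_forward(1)[OF prodsum[OF assms], of "\<lambda>(s, t). s \<otimes> t" "carrier P"]
    unfolding L_mult fib_eq by auto
  moreover have "(a \<otimes>\<^bsub>L\<^esub> b) r = 0" if "r \<notin> carrier P" for r
  proof -
    have "fib r = {}" using that by auto
    then show ?thesis by (simp only: L_mult infsum_empty)
  qed
  ultimately show ?thesis by (simp add: L_carrier)
qed

lemma L_nrm_mult: assumes "a \<in> carrier L" "b \<in> carrier L" shows "nrm L (a \<otimes>\<^bsub>L\<^esub> b) \<le> nrm L a * nrm L b"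
proof -
  have "nrm L (a \<otimes>\<^bsub>L\<^esub> b) \<le> (\<Sum>\<^sub>\<infinity>x \<in> carrier P \<times> carrier P. norm (case x of (s, t) \<Rightarrow> a s * b t))"
    unfolding L_nrm L_mult fib_eq by (rule push_forward(2)[OF prodsum[OF assms]]) auto
  also have "\<dots> = nrm L a * nrm L b"
    using abs_summable_prod(2)[of a "carrier P" b "carrier P"] assms
    by (simp add: L_carrier L_nrm case_prod_unfold)
  finally show ?thesis .
qed

lemma triple_sum:
  assumes "a \<in> carrier L" "b \<in> carrier L" "c \<in> carrier L"
  shows "(\<lambda>(s, t, u). a s * (b t * c u)) abs_summable_on (carrier P \<times> carrier P \<times> carrier P)"
proof -
  have "(\<lambda>(s, x). a s * (case x of (t, u) \<Rightarrow> b t * c u)) abs_summable_on carrier P \<times> (carrier P \<times> carrier P)"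
    by (rule abs_summable_prod(1)[OF _ prodsum[OF assms(2,3)]]) (use assms(1) in \<open>simp add: L_carrier\<close>)
  then show ?thesis by (simp add: case_prod_unfold)
qed

lemma L_assoc:
  assumes "a \<in> carrier L" "b \<in> carrier L" "c \<in> carrier L"
  shows "(a \<otimes>\<^bsub>L\<^esub> b) \<otimes>\<^bsub>L\<^esub> c = a \<otimes>\<^bsub>L\<^esub> (b \<otimes>\<^bsub>L\<^esub> c)"
proof
  fix r
  define T where "T = {(s, t, u). s \<in> carrier P \<and> t \<in> carrier P \<and> u \<in> carrier P \<and> s \<otimes> t \<otimes> u = r}"
  define f where "f = (\<lambda>(s, t, u). a s * (b t * c u))"
  have fT: "f summable_on T" unfolding f_def
    by (rule abs_summable_summable, rule abs_summable_subset[OF triple_sum[OF assms]]) (auto simp: T_def)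
  have "((a \<otimes>\<^bsub>L\<^esub> b) \<otimes>\<^bsub>L\<^esub> c) r = infsum f T"
  proof -
    let ?S = "Sigma (fib r) (\<lambda>z. fib (fst z))"
    let ?h = "\<lambda>x. (fst (snd x), snd (snd x), snd (fst x))"
    have bij: "bij_betw ?h ?S T"
      by (rule bij_betwI[where g = "\<lambda>(s, t, u). ((s \<otimes> t, u), (s, t))"]) (auto simp: T_def)
    have sm: "(\<lambda>x. f (?h x)) summable_on ?S" using summable_on_reindex_bij_betw[OF bij, of f] fT by simp
    have "((a \<otimes>\<^bsub>L\<^esub> b) \<otimes>\<^bsub>L\<^esub> c) r = (\<Sum>\<^sub>\<infinity>z\<in>fib r. \<Sum>\<^sub>\<infinity>w\<in>fib (fst z). f (?h (z, w)))"
      unfolding L_mult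
      by (rule infsum_cong) (auto simp: f_def case_prod_unfold infsum_cmult_left'[symmetric] mult.assoc)
    also have "\<dots> = infsum (\<lambda>x. f (?h x)) ?S" by (rule infsum_Sigma_banach[OF sm])
    also have "\<dots> = infsum f T" by (rule infsum_reindex_bij_betw[OF bij])
    finally show ?thesis .
  qed
  moreover have "(a \<otimes>\<^bsub>L\<^esub> (b \<otimes>\<^bsub>L\<^esub> c)) r = infsum f T"
  proof -
    let ?S = "Sigma (fib r) (\<lambda>z. fib (snd z))"
    let ?h = "\<lambda>x. (fst (fst x), fst (snd x), snd (snd x))"
    have bij: "bij_betw ?h ?S T"
      by (rule bij_betwI[where g = "\<lambda>(s, t, u). ((s, t \<otimes> u), (t, u))"]) (auto simp: T_def m_assoc)
    have sm: "(\<lambda>x. f (?h x)) summable_on ?S" using summable_on_reindex_bij_betw[OF bij, of f] fT by simp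
    have "(a \<otimes>\<^bsub>L\<^esub> (b \<otimes>\<^bsub>L\<^esub> c)) r = (\<Sum>\<^sub>\<infinity>z\<in>fib r. \<Sum>\<^sub>\<infinity>w\<in>fib (snd z). f (?h (z, w)))"
      unfolding L_mult
      by (rule infsum_cong) (auto simp: f_def case_prod_unfold infsum_cmult_right'[symmetric] mult.assoc)
    also have "\<dots> = infsum (\<lambda>x. f (?h x)) ?S" by (rule infsum_Sigma_banach[OF sm])
    also have "\<dots> = infsum f T" by (rule infsum_reindex_bij_betw[OF bij])
    finally show ?thesis .
  qed
  ultimately show "((a \<otimes>\<^bsub>L\<^esub> b) \<otimes>\<^bsub>L\<^esub> c) r = (a \<otimes>\<^bsub>L\<^esub> (b \<otimes>\<^bsub>L\<^esub> c)) r" by simp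
qed

lemma infsum_one_point:
  fixes f :: "'x \<Rightarrow> complex"
  assumes "\<And>x. x \<in> X \<Longrightarrow> x \<noteq> z \<Longrightarrow> f x = 0"
  shows "infsum f X = (if z \<in> X then f z else 0)"
proof -
  have "infsum f X = infsum f (X \<inter> {z})"
    by (rule infsum_cong_neutral) (use assms in auto)
  then show ?thesis by (auto simp: Int_insert_right)
qed

lemma L_one_closed: "\<one>\<^bsub>L\<^esub> \<in> carrier L"
proof -
  have "(\<lambda>r. norm (\<one>\<^bsub>L\<^esub> r)) summable_on {\<one>}" by simp
  then have "(\<lambda>r. norm (\<one>\<^bsub>L\<^esub> r)) summable_on carrier P"
    by (rule summable_on_cong_neutral[THEN iffD1, rotated -1]) (auto simp: L_one)
  then show ?thesis by (auto simp: L_carrier L_one)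
qed

lemma L_one_mult: assumes a: "a \<in> carrier L" shows "\<one>\<^bsub>L\<^esub> \<otimes>\<^bsub>L\<^esub> a = a" "a \<otimes>\<^bsub>L\<^esub> \<one>\<^bsub>L\<^esub> = a"
proof -
  have "(\<one>\<^bsub>L\<^esub> \<otimes>\<^bsub>L\<^esub> a) r = a r" for r
  proof -
    have "(\<one>\<^bsub>L\<^esub> \<otimes>\<^bsub>L\<^esub> a) r = (if (\<one>, r) \<in> fib r then 1 * a r else 0)"
      unfolding L_mult L_one by (subst infsum_one_point[of _ "(\<one>, r)"]) (auto split: if_splits)
    then show ?thesis using a by (auto simp: L_carrier)
  qed
  then show "\<one>\<^bsub>L\<^esub> \<otimes>\<^bsub>L\<^esub> a = a" by auto
  have "(a \<otimes>\<^bsub>L\<^esub> \<one>\<^bsub>L\<^esub>) r = a r" for r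
  proof -
    have "(a \<otimes>\<^bsub>L\<^esub> \<one>\<^bsub>L\<^esub>) r = (if (r, \<one>) \<in> fib r then a r * 1 else 0)"
      unfolding L_mult L_one by (subst infsum_one_point[of _ "(r, \<one>)"]) (auto split: if_splits)
    then show ?thesis using a by (auto simp: L_carrier)
  qed
  then show "a \<otimes>\<^bsub>L\<^esub> \<one>\<^bsub>L\<^esub> = a" by auto
qed

lemma L_add_closed: assumes "a \<in> carrier L" "b \<in> carrier L" shows "a \<oplus>\<^bsub>L\<^esub> b \<in> carrier L"
proof -
  have s: "(\<lambda>r. norm (a r) + norm (b r)) summable_on carrier P"
    using assms by (intro summable_on_add) (auto simp: L_carrier)
  have "(\<lambda>r. a r + b r) abs_summable_on carrier P"
    by (rule abs_summable_on_comparison_test[where g = "\<lambda>r. norm (a r) + norm (b r)"])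
      (use s in \<open>auto intro: norm_triangle_ineq\<close>)
  then show ?thesis using assms by (auto simp: L_carrier L_add)
qed

lemma L_cscale_closed: assumes "a \<in> carrier L" shows "cscale L c a \<in> carrier L"
  using assms by (auto simp: L_carrier L_cscale norm_mult intro: summable_on_cmult_right)

lemma i_bij: "bij_betw i (carrier P) (carrier P)"
  by (rule bij_betwI[where g = i]) (auto simp: i_closed i_i)

lemma L_adj_closed: assumes "a \<in> carrier L" shows "adj L a \<in> carrier L"
proof -
  have "(\<lambda>r. norm (a (i r))) summable_on carrier P"
    using summable_on_reindex_bij_betw[OF i_bij, of "\<lambda>r. norm (a r)"] assms by (simp add: L_carrier)
  then have "(\<lambda>r. norm (adj L a r)) summable_on carrier P"
    by (rule summable_on_cong[THEN iffD1, rotated]) (auto simp: L_adj)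
  then show ?thesis by (auto simp: L_carrier L_adj)
qed

lemma L_adj_mult: assumes "a \<in> carrier L" "b \<in> carrier L"
  shows "adj L (a \<otimes>\<^bsub>L\<^esub> b) = adj L b \<otimes>\<^bsub>L\<^esub> adj L a"
proof
  fix r
  show "adj L (a \<otimes>\<^bsub>L\<^esub> b) r = (adj L b \<otimes>\<^bsub>L\<^esub> adj L a) r"
  proof (cases "r \<in> carrier P")
    case False
    then have "fib r = {}" by auto
    then show ?thesis using False by (simp only: L_mult L_adj infsum_empty if_False)
  next
    case True
    have bij: "bij_betw (\<lambda>(s, t). (i t, i s)) (fib r) (fib (i r))"
      by (rule bij_betwI[where g = "\<lambda>(s, t). (i t, i s)"]) (auto simp: i_closed i_i i_mult[symmetric] True)
    have "(adj L b \<otimes>\<^bsub>L\<^esub> adj L a) r = (\<Sum>\<^sub>\<infinity>x\<in>fib r. (\<lambda>(s, t). cnj (a s * b t)) ((\<lambda>(s, t). (i t, i s)) x))"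
      unfolding L_mult L_adj by (rule infsum_cong) auto
    also have "\<dots> = (\<Sum>\<^sub>\<infinity>(s, t)\<in>fib (i r). cnj (a s * b t))"
      by (rule infsum_reindex_bij_betw[OF bij])
    also have "\<dots> = cnj (\<Sum>\<^sub>\<infinity>(s, t)\<in>fib (i r). a s * b t)"
      by (subst infsum_cnj[symmetric]) (simp add: case_prod_unfold)
    finally show ?thesis using True by (simp add: L_adj L_mult)
  qed
qed

lemma L_distrib: assumes "a \<in> carrier L" "b \<in> carrier L" "c \<in> carrier L"
  shows "(a \<oplus>\<^bsub>L\<^esub> b) \<otimes>\<^bsub>L\<^esub> c = a \<otimes>\<^bsub>L\<^esub> c \<oplus>\<^bsub>L\<^esub> b \<otimes>\<^bsub>L\<^esub> c"
    "c \<otimes>\<^bsub>L\<^esub> (a \<oplus>\<^bsub>L\<^esub> b) = c \<otimes>\<^bsub>L\<^esub> a \<oplus>\<^bsub>L\<^esub> c \<otimes>\<^bsub>L\<^esub> b"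
proof -
  show "(a \<oplus>\<^bsub>L\<^esub> b) \<otimes>\<^bsub>L\<^esub> c = a \<otimes>\<^bsub>L\<^esub> c \<oplus>\<^bsub>L\<^esub> b \<otimes>\<^bsub>L\<^esub> c"
  proof
    fix r show "((a \<oplus>\<^bsub>L\<^esub> b) \<otimes>\<^bsub>L\<^esub> c) r = (a \<otimes>\<^bsub>L\<^esub> c \<oplus>\<^bsub>L\<^esub> b \<otimes>\<^bsub>L\<^esub> c) r"
      unfolding L_mult L_add
      using infsum_add[OF fibsum[OF assms(1,3), of r] fibsum[OF assms(2,3), of r]]
      by (simp add: case_prod_unfold distrib_right)
  qed
  show "c \<otimes>\<^bsub>L\<^esub> (a \<oplus>\<^bsub>L\<^esub> b) = c \<otimes>\<^bsub>L\<^esub> a \<oplus>\<^bsub>L\<^esub> c \<otimes>\<^bsub>L\<^esub> b"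
  proof
    fix r show "(c \<otimes>\<^bsub>L\<^esub> (a \<oplus>\<^bsub>L\<^esub> b)) r = (c \<otimes>\<^bsub>L\<^esub> a \<oplus>\<^bsub>L\<^esub> c \<otimes>\<^bsub>L\<^esub> b) r"
      unfolding L_mult L_add
      using infsum_add[OF fibsum[OF assms(3,1), of r] fibsum[OF assms(3,2), of r]]
      by (simp add: case_prod_unfold distrib_left)
  qed
qed

lemma L_ring: "ring L"
proof (rule ringI)
  show "abelian_group L"
  proof (rule abelian_groupI)
    fix a assume a: "a \<in> carrier L"
    show "\<exists>b\<in>carrier L. b \<oplus>\<^bsub>L\<^esub> a = \<zero>\<^bsub>L\<^esub>"
      by (rule bexI[OF _ L_cscale_closed[OF a, of "-1"]]) (simp add: L_add L_cscale L_zero)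
    show "\<zero>\<^bsub>L\<^esub> \<oplus>\<^bsub>L\<^esub> a = a" by (simp add: L_add L_zero)
  next
    show "\<zero>\<^bsub>L\<^esub> \<in> carrier L" by (simp add: L_carrier L_zero)
  next
    fix a b assume "a \<in> carrier L" "b \<in> carrier L"
    then show "a \<oplus>\<^bsub>L\<^esub> b \<in> carrier L" by (rule L_add_closed)
    show "a \<oplus>\<^bsub>L\<^esub> b = b \<oplus>\<^bsub>L\<^esub> a" by (simp add: L_add add.commute)
  next
    fix a b c show "(a \<oplus>\<^bsub>L\<^esub> b) \<oplus>\<^bsub>L\<^esub> c = a \<oplus>\<^bsub>L\<^esub> (b \<oplus>\<^bsub>L\<^esub> c)" by (simp add: L_add add.assoc)
  qed
  show "monoid L"
    by (rule monoidI) (auto simp: L_mult_closed L_one_closed L_one_mult L_assoc)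
qed (auto simp: L_distrib)

theorem l1_normed: "normed_star_algebra L"
proof (intro normed_star_algebra.intro L_ring normed_star_algebra_axioms.intro)
  fix a b c d assume a: "a \<in> carrier L"
  show "cscale L c a \<in> carrier L" "adj L a \<in> carrier L" using a by (rule L_cscale_closed, rule L_adj_closed)
  show "cscale L (c + d) a = cscale L c a \<oplus>\<^bsub>L\<^esub> cscale L d a" "cscale L c (cscale L d a) = cscale L (c * d) a"
    "cscale L 1 a = a" "adj L (cscale L c a) = cscale L (cnj c) (adj L a)"
    by (auto simp: L_cscale L_add L_adj algebra_simps)
  show "adj L (adj L a) = a" using a by (auto simp: L_adj L_carrier i_i i_closed)
  show "0 \<le> nrm L a" by (simp add: L_nrm infsum_nonneg)
  show "nrm L a = 0 \<longleftrightarrow> a = \<zero>\<^bsub>L\<^esub>"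
  proof
    assume z: "nrm L a = 0"
    have "a r = 0" if "r \<in> carrier P" for r
      using nonneg_infsum_le_0D[of "\<lambda>r. cmod (a r)" "carrier P" r] that z a by (auto simp: L_nrm L_carrier)
    then show "a = \<zero>\<^bsub>L\<^esub>" using a by (auto simp: L_zero L_carrier)
  qed (simp add: L_nrm L_zero)
  show "nrm L (cscale L c a) = cmod c * nrm L a"
    by (simp add: L_nrm L_cscale norm_mult infsum_cmult_right')
  show "nrm L (adj L a) = nrm L a"
  proof -
    have "nrm L (adj L a) = (\<Sum>\<^sub>\<infinity>r\<in>carrier P. cmod (a (i r)))"
      unfolding L_nrm by (rule infsum_cong) (simp add: L_adj)
    also have "\<dots> = nrm L a" unfolding L_nrm by (rule infsum_reindex_bij_betw[OF i_bij])
    finally show ?thesis .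
  qed
  assume b: "b \<in> carrier L"
  show "nrm L (a \<oplus>\<^bsub>L\<^esub> b) \<le> nrm L a + nrm L b"
  proof -
    have "nrm L (a \<oplus>\<^bsub>L\<^esub> b) \<le> (\<Sum>\<^sub>\<infinity>r\<in>carrier P. cmod (a r) + cmod (b r))"
      unfolding L_nrm using a b L_add_closed[OF a b]
      by (intro infsum_mono summable_on_add) (auto simp: L_carrier L_add norm_triangle_ineq)
    also have "\<dots> = nrm L a + nrm L b"
      unfolding L_nrm using a b by (intro infsum_add) (auto simp: L_carrier)
    finally show ?thesis .
  qed
  show "nrm L (a \<otimes>\<^bsub>L\<^esub> b) \<le> nrm L a * nrm L b" using a b by (rule L_nrm_mult)
  show "adj L (a \<otimes>\<^bsub>L\<^esub> b) = adj L b \<otimes>\<^bsub>L\<^esub> adj L a" using a b by (rule L_adj_mult)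
  show "cscale L c (a \<oplus>\<^bsub>L\<^esub> b) = cscale L c a \<oplus>\<^bsub>L\<^esub> cscale L c b"
    "adj L (a \<oplus>\<^bsub>L\<^esub> b) = adj L a \<oplus>\<^bsub>L\<^esub> adj L b"
    by (auto simp: L_cscale L_add L_adj algebra_simps)
  show "cscale L c a \<otimes>\<^bsub>L\<^esub> b = cscale L c (a \<otimes>\<^bsub>L\<^esub> b)" 
    by (rule ext) (simp add: L_mult L_cscale infsum_cmult_right'[symmetric] case_prod_unfold mult.assoc)
  show "a \<otimes>\<^bsub>L\<^esub> cscale L c b = cscale L c (a \<otimes>\<^bsub>L\<^esub> b)"
    by (rule ext) (simp add: L_mult L_cscale infsum_cmult_right'[symmetric] case_prod_unfold mult.left_commute)
qed

end

subsection \<open>The left inverse hull\<close>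

lemma partial_inv_iff:
  assumes "inj_on f (dom f)" shows "partial_inv f y = Some x \<longleftrightarrow> f x = Some y"
proof
  assume "f x = Some y"
  moreover then have "(THE x. f x = Some y) = x"
    using assms by (intro the_equality) (auto simp: inj_on_def dom_def)
  ultimately show "partial_inv f y = Some x" by (auto simp: partial_inv_def ran_def)
next
  assume h: "partial_inv f y = Some x"
  then obtain x' where x': "f x' = Some y" by (auto simp: partial_inv_def ran_def split: if_splits)
  moreover then have "(THE x. f x = Some y) = x'"
    using assms by (intro the_equality) (auto simp: inj_on_def dom_def)
  ultimately show "f x = Some y" using h by (auto simp: partial_inv_def split: if_splits)
qed

lemma pb_iff: "f \<in> partial_bijections X \<longleftrightarrow>
  (\<forall>x y. f x = Some y \<longrightarrow> x \<in> X \<and> y \<in> X) \<and> (\<forall>x x' y. f x = Some y \<longrightarrow> f x' = Some y \<longrightarrow> x = x')"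
  unfolding partial_bijections_def by (auto simp: inj_on_def dom_def ran_def) 

lemma pb_inj: "f \<in> partial_bijections X \<Longrightarrow> inj_on f (dom f)" by (simp add: partial_bijections_def)

lemmas pinv = partial_inv_iff[OF pb_inj]

lemma pb_comp: "f \<in> partial_bijections X \<Longrightarrow> g \<in> partial_bijections X \<Longrightarrow> f \<circ>\<^sub>m g \<in> partial_bijections X"
  unfolding pb_iff map_comp_Some_iff by blast

lemma pb_inv: "f \<in> partial_bijections X \<Longrightarrow> partial_inv f \<in> partial_bijections X"
  unfolding pb_iff[of "partial_inv f"] by (simp add: pinv) (simp add: pb_iff)

lemma partial_map_eqI: "(\<And>x y. f x = Some y \<longleftrightarrow> g x = Some y) \<Longrightarrow> f = g"
  by (rule ext) (metis option.exhaust)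

lemma pb_inv_inv: "f \<in> partial_bijections X \<Longrightarrow> partial_inv (partial_inv f) = f"
  by (rule partial_map_eqI) (simp add: pinv[OF pb_inv] pinv)

lemma pb_inv_comp: "f \<in> partial_bijections X \<Longrightarrow> g \<in> partial_bijections X \<Longrightarrow>
  partial_inv (f \<circ>\<^sub>m g) = partial_inv g \<circ>\<^sub>m partial_inv f"
  by (rule partial_map_eqI) (auto simp: pinv[OF pb_comp] pinv map_comp_Some_iff)

lemma pb_fif: assumes "f \<in> partial_bijections X" shows "f \<circ>\<^sub>m partial_inv f \<circ>\<^sub>m f = f"
  by (rule partial_map_eqI) (auto simp: pinv[OF assms] map_comp_Some_iff)

lemma pb_unique:
  assumes f: "f \<in> partial_bijections X" and g: "g \<in> partial_bijections X"
    and "f \<circ>\<^sub>m g \<circ>\<^sub>m f = f" "g \<circ>\<^sub>m f \<circ>\<^sub>m g = g"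
  shows "g = partial_inv f"
proof (rule partial_map_eqI)
  fix x y
  have inj: "\<And>x x' y. f x = Some y \<Longrightarrow> f x' = Some y \<Longrightarrow> x = x'" "\<And>x x' y. g x = Some y \<Longrightarrow> g x' = Some y \<Longrightarrow> x = x'"
    using f g unfolding pb_iff by blast+
  have "f x = Some y" if gy: "g y = Some x"
  proof -
    have "(g \<circ>\<^sub>m f \<circ>\<^sub>m g) y = Some x" using that assms(4) by simp
    then obtain v where "f x = Some v" "g v = Some x" using gy by (auto simp: map_comp_Some_iff)
    then show ?thesis using inj(2)[of v x y] that by simp
  qed
  moreover have "g y = Some x" if fx: "f x = Some y"
  proof -
    have "(f \<circ>\<^sub>m g \<circ>\<^sub>m f) x = Some y" using that assms(3) by simp
    then obtain v where "g y = Some v" "f v = Some y" using fx by (auto simp: map_comp_Some_iff)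
    then show ?thesis using inj(1)[of v y x] that by simp
  qed
  ultimately show "g y = Some x \<longleftrightarrow> partial_inv f y = Some x" by (auto simp: pinv[OF f])
qed

lemma partial_comp_assoc: "f \<circ>\<^sub>m g \<circ>\<^sub>m h = f \<circ>\<^sub>m (g \<circ>\<^sub>m h)"
  by (rule partial_map_eqI) (auto simp: map_comp_Some_iff)

context
  fixes S :: "('s, 'm) monoid_scheme"
  assumes S: "monoid S" "left_cancellative S"
begin

lemma hull_pb: "f \<in> carrier (left_inverse_hull S) \<Longrightarrow> f \<in> partial_bijections (carrier S)"
proof -
  interpret S: monoid S by fact
  assume "f \<in> carrier (left_inverse_hull S)"
  then have "f \<in> inverse_generate (left_translation S ` carrier S)" by (simp add: left_inverse_hull_def)
  then show ?thesis
  proof induction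
    case (incl f) 
    then show ?case using S(2) by (auto simp: pb_iff left_translation_def left_cancellative_def split: if_splits)
  qed (simp_all add: pb_comp pb_inv)
qed

lemma hull_ops:
  "f \<otimes>\<^bsub>left_inverse_hull S\<^esub> g = f \<circ>\<^sub>m g" 
  "\<one>\<^bsub>left_inverse_hull S\<^esub> = left_translation S \<one>\<^bsub>S\<^esub>"
  "carrier (left_inverse_hull S) = inverse_generate (left_translation S ` carrier S)"
  using S(1) by (auto simp: left_inverse_hull_def symmetric_inverse_semigroup_def left_translation_def restrict_map_def monoid.l_one)

lemma hull_monoid: "monoid (left_inverse_hull S)"
proof (rule monoidI)
  interpret S: monoid S by fact
  fix f g h assume f: "f \<in> carrier (left_inverse_hull S)"
  show "\<one>\<^bsub>left_inverse_hull S\<^esub> \<otimes>\<^bsub>left_inverse_hull S\<^esub> f = f" "f \<otimes>\<^bsub>left_inverse_hull S\<^esub> \<one>\<^bsub>left_inverse_hull S\<^esub> = f"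
    using hull_pb[OF f]
    by (auto intro!: partial_map_eqI simp: hull_ops map_comp_Some_iff left_translation_def pb_iff split: if_splits)
  show "f \<otimes>\<^bsub>left_inverse_hull S\<^esub> g \<otimes>\<^bsub>left_inverse_hull S\<^esub> h = f \<otimes>\<^bsub>left_inverse_hull S\<^esub> (g \<otimes>\<^bsub>left_inverse_hull S\<^esub> h)"
    by (simp add: hull_ops partial_comp_assoc)
  assume g: "g \<in> carrier (left_inverse_hull S)"
  show "f \<otimes>\<^bsub>left_inverse_hull S\<^esub> g \<in> carrier (left_inverse_hull S)"
    using f g by (simp add: hull_ops inverse_generate.comp)
next
  interpret S: monoid S by fact
  show "\<one>\<^bsub>left_inverse_hull S\<^esub> \<in> carrier (left_inverse_hull S)" by (auto simp: hull_ops intro: inverse_generate.incl)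
qed

lemma hull_inv_props: assumes "f \<in> carrier (left_inverse_hull S)"
  shows "g \<in> carrier (left_inverse_hull S) \<and> f \<otimes>\<^bsub>left_inverse_hull S\<^esub> g \<otimes>\<^bsub>left_inverse_hull S\<^esub> f = f \<and> g \<otimes>\<^bsub>left_inverse_hull S\<^esub> f \<otimes>\<^bsub>left_inverse_hull S\<^esub> g = g \<longleftrightarrow> g = partial_inv f"
proof -
  have "partial_inv f \<in> carrier (left_inverse_hull S)" using assms by (simp add: hull_ops inverse_generate.inv)
  moreover have "f \<circ>\<^sub>m partial_inv f \<circ>\<^sub>m f = f" "partial_inv f \<circ>\<^sub>m f \<circ>\<^sub>m partial_inv f = partial_inv f"
    using pb_fif[OF hull_pb[OF assms]] pb_fif[OF pb_inv[OF hull_pb[OF assms]]] pb_inv_inv[OF hull_pb[OF assms]] by simp_all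
  moreover have "g = partial_inv f"
    if "g \<in> carrier (left_inverse_hull S)" "f \<circ>\<^sub>m g \<circ>\<^sub>m f = f" "g \<circ>\<^sub>m f \<circ>\<^sub>m g = g"
    using hull_pb[OF assms] hull_pb[OF that(1)] that(2,3) by (rule pb_unique)
  ultimately show ?thesis
    unfolding hull_ops(1) by metis
qed

theorem hull_inverse_semigroup: "inverse_semigroup (left_inverse_hull S)"
  unfolding inverse_semigroup_def
proof (intro conjI hull_monoid ballI)
  fix f assume f: "f \<in> carrier (left_inverse_hull S)"
  show "\<exists>!g. g \<in> carrier (left_inverse_hull S) \<and> f \<otimes>\<^bsub>left_inverse_hull S\<^esub> g \<otimes>\<^bsub>left_inverse_hull S\<^esub> f = f \<and>
      g \<otimes>\<^bsub>left_inverse_hull S\<^esub> f \<otimes>\<^bsub>left_inverse_hull S\<^esub> g = g"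
    by (simp only: hull_inv_props[OF f] ex1_eq)
qed

theorem hull_semigroup_inv: "f \<in> carrier (left_inverse_hull S) \<Longrightarrow> semigroup_inv (left_inverse_hull S) f = partial_inv f"
  unfolding semigroup_inv_def using hull_inv_props[of f] by simp

lemma hull_involutive: "involutive_monoid (left_inverse_hull S) (semigroup_inv (left_inverse_hull S))"
proof -
  interpret H: monoid "left_inverse_hull S" by (rule hull_monoid)
  have c: "f \<in> carrier (left_inverse_hull S) \<Longrightarrow> partial_inv f \<in> carrier (left_inverse_hull S)" for f
    by (simp add: hull_ops inverse_generate.inv)
  show ?thesis
  proof unfold_locales
    fix f assume f: "f \<in> carrier (left_inverse_hull S)"
    show "semigroup_inv (left_inverse_hull S) f \<in> carrier (left_inverse_hull S)"
      by (simp only: hull_semigroup_inv[OF f] c[OF f])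
    show "semigroup_inv (left_inverse_hull S) (semigroup_inv (left_inverse_hull S) f) = f"
      by (simp only: hull_semigroup_inv[OF f] hull_semigroup_inv[OF c[OF f]] pb_inv_inv[OF hull_pb[OF f]])
    fix g assume g: "g \<in> carrier (left_inverse_hull S)"
    show "semigroup_inv (left_inverse_hull S) (f \<otimes>\<^bsub>left_inverse_hull S\<^esub> g) =
      semigroup_inv (left_inverse_hull S) g \<otimes>\<^bsub>left_inverse_hull S\<^esub> semigroup_inv (left_inverse_hull S) f"
      unfolding hull_semigroup_inv[OF f] hull_semigroup_inv[OF g] hull_semigroup_inv[OF H.m_closed[OF f g]]
      unfolding hull_ops(1) by (rule pb_inv_comp[OF hull_pb[OF f] hull_pb[OF g]])
  qed
qed

theorem hull_cstar_algebra: "cstar_algebra (inverse_semigroup_cstar (left_inverse_hull S))"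
  unfolding inverse_semigroup_cstar_def
  by (rule normed_star_algebra.enveloping_cstar_algebra[OF involutive_monoid.l1_normed[OF hull_involutive]])

end

theorem group_cstar_algebra: assumes "group G" shows "cstar_algebra (group_cstar G)"
proof -
  interpret G: group G by fact
  have "involutive_monoid G (m_inv G)" by unfold_locales (simp_all add: G.inv_mult_group)
  then show ?thesis
    unfolding group_cstar_def
    by (rule normed_star_algebra.enveloping_cstar_algebra[OF involutive_monoid.l1_normed])
qed

end

theory Submission
  imports Defs
begin

text \<open>
  Every \<open>f\<close> in the left inverse hull commutes with right multiplications, so its domain and its range
  are right ideals, and left reversibility keeps the domains of compositions nonempty. Hence there is
  exactly one \<open>g\<close> in the group with \<open>\<phi> (f t) = g \<phi> t\<close> on the domain of \<open>f\<close>, and \<open>f \<mapsto> g\<close> is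
  a homomorphism of involutive monoids extending \<open>\<phi>\<close>. Pushing forward along it is a contractive
  *-homomorphism of the convolution algebras, which passes to the enveloping C*-algebras.
\<close>

section \<open>Products of absolutely convergent sums and the canonical map into the enveloping
  C*-algebra\<close>

text \<open>Absolute summability of the product family allows the double sum to be iterated. In
  \<open>push_mult\<close> this expands a product of two fibre sums.\<close>

lemma infsum_mult_prod:
  fixes a b :: "_ \<Rightarrow> complex"
  assumes "a abs_summable_on C" and "b abs_summable_on D"
  shows "infsum a C * infsum b D = (\<Sum>\<^sub>\<infinity>(s, t) \<in> C \<times> D. a s * b t)"
proof -
  have "(\<lambda>(s, t). a s * b t) summable_on C \<times> D"
    by (rule abs_summable_summable[OF abs_summable_prod(1)[OF assms]])
  then have "(\<Sum>\<^sub>\<infinity>(s, t) \<in> C \<times> D. a s * b t) = (\<Sum>\<^sub>\<infinity>s\<in>C. \<Sum>\<^sub>\<infinity>t\<in>D. a s * b t)"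
    by (rule infsum_Sigma'_banach[symmetric])
  then show ?thesis by (simp add: infsum_cmult_right' infsum_cmult_left')
qed

lemma star_hom_comp:
  assumes "f \<in> star_hom A B" "g \<in> star_hom B C"
  shows "(\<lambda>a. g (f a)) \<in> star_hom A C"
  using assms by (auto simp: star_hom_def Pi_def)

text \<open>The operations of the completion are computed on representatives, which here are
  constant sequences.\<close>

lemma (in normed_star_algebra) enveloping_map_star_hom:
  "enveloping_map A \<in> star_hom A (enveloping_cstar A)"
proof -
  interpret u: cstar_seminormed A "enveloping_seminorm A" by (rule enveloping_seminormed)
  show ?thesis
    by (auto simp: star_hom_def enveloping_cstar_def enveloping_map_def u.cl_def[symmetric]
        u.H_carrier u.H_ops u.CS_ops u.cl_in)
qed

lemma (in normed_star_algebra) enveloping_map_contractive: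
  assumes "a \<in> carrier A"
  shows "nrm (enveloping_cstar A) (enveloping_map A a) \<le> nrm A a"
proof -
  interpret u: cstar_seminormed A "enveloping_seminorm A" by (rule enveloping_seminormed)
  \<comment> \<open>The norm of a class is the limit of the seminorms along a representative, and
    this one is constant.\<close>
  have "nrm u.H (u.cl (\<lambda>n. a)) = enveloping_seminorm A a"
    using assms by (intro u.H_nrm) (auto simp: u.CS_const)
  then show ?thesis
    using u.p_le[OF assms] by (simp add: enveloping_cstar_def enveloping_map_def u.cl_def)
qed

subsection \<open>Functoriality of convolution algebras\<close>

locale involutive_monoid_hom = P: involutive_monoid P i + Q: involutive_monoid Q j
  for P :: "('p, 'm) monoid_scheme" and i and Q :: "('q, 'n) monoid_scheme" and j +
  fixes \<psi> :: "'p \<Rightarrow> 'q"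
  assumes hom: "\<psi> \<in> hom P Q"
    and hom_inv: "x \<in> carrier P \<Longrightarrow> \<psi> (i x) = j (\<psi> x)"
begin

lemma closed: "x \<in> carrier P \<Longrightarrow> \<psi> x \<in> carrier Q"
  and mult: "x \<in> carrier P \<Longrightarrow> y \<in> carrier P \<Longrightarrow> \<psi> (x \<otimes>\<^bsub>P\<^esub> y) = \<psi> x \<otimes>\<^bsub>Q\<^esub> \<psi> y"
  using hom by (auto simp: hom_def)

text \<open>The image of \<open>a\<close>, seen as a complex measure on \<open>P\<close>, under
  \<psi>. Empty fibres give 0, so \<open>push a\<close> vanishes off the image of \<psi>.\<close>

definition push :: "('p \<Rightarrow> complex) \<Rightarrow> 'q \<Rightarrow> complex" where
  "push a r = infsum a {x \<in> carrier P. \<psi> x = r}"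

lemma fibre_summable:
  assumes "a \<in> carrier P.L"
  shows "a abs_summable_on {x \<in> carrier P. \<psi> x = r}" and "a summable_on {x \<in> carrier P. \<psi> x = r}"
proof -
  show "a abs_summable_on {x \<in> carrier P. \<psi> x = r}"
    by (rule abs_summable_subset[of _ "carrier P"]) (use assms in \<open>auto simp: P.L_carrier\<close>)
  then show "a summable_on {x \<in> carrier P. \<psi> x = r}" by (rule abs_summable_summable)
qed

lemma push_closed: assumes a: "a \<in> carrier P.L" shows "push a \<in> carrier Q.L"
  unfolding Q.L_carrier
proof (intro conjI allI impI)
  show "push a abs_summable_on carrier Q"
    unfolding push_def by (rule push_forward(1)) (use a closed in \<open>auto simp: P.L_carrier\<close>)
  fix r assume "r \<notin> carrier Q"
  then have "{x \<in> carrier P. \<psi> x = r} = {}" using closed by auto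
  then show "push a r = 0" by (simp only: push_def infsum_empty)
qed

lemma push_contractive: assumes a: "a \<in> carrier P.L" shows "nrm Q.L (push a) \<le> nrm P.L a"
  unfolding P.L_nrm Q.L_nrm push_def
  by (rule push_forward(2)) (use a closed in \<open>auto simp: P.L_carrier\<close>)

text \<open>Both sides at \<open>r\<close> sum \<open>a s * b t\<close> over the set
  \<open>T\<close> of pairs whose images multiply to \<open>r\<close>. The left side groups these
  pairs by their product in \<open>P\<close>, the right side by the pair of their images in
  \<open>Q\<close>.\<close>

lemma push_mult:
  assumes a: "a \<in> carrier P.L" and b: "b \<in> carrier P.L"
  shows "push (a \<otimes>\<^bsub>P.L\<^esub> b) = push a \<otimes>\<^bsub>Q.L\<^esub> push b"
proof
  fix r
  let ?F = "\<lambda>g. {x \<in> carrier P. \<psi> x = g}"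
  define T where "T = {(s, t). s \<in> carrier P \<and> t \<in> carrier P \<and> \<psi> s \<otimes>\<^bsub>Q\<^esub> \<psi> t = r}"
  define f where "f = (\<lambda>(s, t). a s * b t)"
  have fT: "f summable_on T" unfolding f_def
    by (rule abs_summable_summable, rule abs_summable_subset[OF P.prodsum[OF a b]]) (auto simp: T_def)
  have "push (a \<otimes>\<^bsub>P.L\<^esub> b) r = infsum f T"
  proof -
    let ?S = "Sigma (?F r) P.fib"
    have bij: "bij_betw snd ?S T"
      by (rule bij_betwI[where g = "\<lambda>(s, t). (s \<otimes>\<^bsub>P\<^esub> t, (s, t))"]) (auto simp: T_def mult)
    have sm: "(\<lambda>x. f (snd x)) summable_on ?S" using summable_on_reindex_bij_betw[OF bij, of f] fT by simp
    have "push (a \<otimes>\<^bsub>P.L\<^esub> b) r = (\<Sum>\<^sub>\<infinity>x\<in>?F r. \<Sum>\<^sub>\<infinity>w\<in>P.fib x. f (snd (x, w)))"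
      unfolding push_def P.L_mult f_def by simp
    also have "\<dots> = infsum (\<lambda>x. f (snd x)) ?S" by (rule infsum_Sigma_banach[OF sm])
    also have "\<dots> = infsum f T" by (rule infsum_reindex_bij_betw[OF bij])
    finally show ?thesis .
  qed
  moreover have "(push a \<otimes>\<^bsub>Q.L\<^esub> push b) r = infsum f T"
  proof -
    let ?S = "Sigma (Q.fib r) (\<lambda>z. ?F (fst z) \<times> ?F (snd z))"
    have bij: "bij_betw snd ?S T"
      by (rule bij_betwI[where g = "\<lambda>(s, t). ((\<psi> s, \<psi> t), (s, t))"]) (auto simp: T_def closed)
    have sm: "(\<lambda>x. f (snd x)) summable_on ?S" using summable_on_reindex_bij_betw[OF bij, of f] fT by simp
    have "(push a \<otimes>\<^bsub>Q.L\<^esub> push b) r = (\<Sum>\<^sub>\<infinity>z\<in>Q.fib r. \<Sum>\<^sub>\<infinity>w\<in>?F (fst z) \<times> ?F (snd z). f (snd (z, w)))"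
      unfolding Q.L_mult push_def f_def
      \<comment> \<open>The product of the two fibre sums becomes one sum over the product of the
        fibres.\<close>
      by (rule infsum_cong)
        (simp add: case_prod_unfold
          infsum_mult_prod[OF fibre_summable(1)[OF a] fibre_summable(1)[OF b], unfolded case_prod_unfold])
    also have "\<dots> = infsum (\<lambda>x. f (snd x)) ?S" by (rule infsum_Sigma_banach[OF sm])
    also have "\<dots> = infsum f T" by (rule infsum_reindex_bij_betw[OF bij])
    finally show ?thesis .
  qed
  ultimately show "push (a \<otimes>\<^bsub>P.L\<^esub> b) r = (push a \<otimes>\<^bsub>Q.L\<^esub> push b) r" by simp
qed

lemma push_adj: "push (adj P.L a) = adj Q.L (push a)"
proof
  fix r
  show "push (adj P.L a) r = adj Q.L (push a) r"
  proof (cases "r \<in> carrier Q")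
    case False
    then have "{x \<in> carrier P. \<psi> x = r} = {}" using closed by auto
    then show ?thesis using False by (simp only: push_def Q.L_adj infsum_empty if_False)
  next
    case True
    \<comment> \<open>As \<psi> intertwines the involutions, \<open>i\<close> exchanges the fibres
      over \<open>r\<close> and \<open>j r\<close>.\<close>
    have bij: "bij_betw i {x \<in> carrier P. \<psi> x = r} {x \<in> carrier P. \<psi> x = j r}"
      by (rule bij_betwI[where g = i]) (auto simp: P.i_closed P.i_i hom_inv Q.i_i True)
    have "push (adj P.L a) r = (\<Sum>\<^sub>\<infinity>x \<in> {x \<in> carrier P. \<psi> x = r}. cnj (a (i x)))"
      unfolding push_def P.L_adj by (rule infsum_cong) simp
    also have "\<dots> = (\<Sum>\<^sub>\<infinity>x \<in> {x \<in> carrier P. \<psi> x = j r}. cnj (a x))"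
      by (rule infsum_reindex_bij_betw[OF bij])
    finally show ?thesis using True by (simp add: Q.L_adj push_def infsum_cnj)
  qed
qed

lemma push_star_hom: "push \<in> star_hom P.L Q.L"
  unfolding star_hom_def
proof (intro CollectI conjI ballI allI funcsetI)
  fix a b c assume a: "a \<in> carrier P.L" and b: "b \<in> carrier P.L"
  show "push (a \<oplus>\<^bsub>P.L\<^esub> b) = push a \<oplus>\<^bsub>Q.L\<^esub> push b"
    by (rule ext) (simp add: P.L_add Q.L_add push_def infsum_add fibre_summable a b)
qed (auto simp: push_closed push_mult push_adj push_def P.L_cscale Q.L_cscale infsum_cmult_right' fun_eq_iff)

lemma push_delta:
  assumes "s \<in> carrier P"
  shows "push (\<lambda>x. if x = s then 1 else 0) = (\<lambda>r. if r = \<psi> s then 1 else 0)"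
proof
  fix r
  show "push (\<lambda>x. if x = s then 1 else 0) r = (if r = \<psi> s then 1 else 0)"
    unfolding push_def by (subst P.infsum_one_point[of _ s]) (use assms in auto)
qed

lemma delta_closed: assumes "s \<in> carrier P" shows "(\<lambda>x. if x = s then 1 else 0) \<in> carrier P.L"
proof -
  have "(\<lambda>x. norm (if x = s then 1 else 0 :: complex)) summable_on {s}" by simp
  then have "(\<lambda>x. norm (if x = s then 1 else 0 :: complex)) summable_on carrier P"
    by (rule summable_on_cong_neutral[THEN iffD1, rotated -1]) (use assms in auto)
  then show ?thesis using assms by (auto simp: P.L_carrier)
qed

text \<open>Pushing forward and then mapping into the enveloping algebra of the target is a
  contractive *-homomorphism into a C*-algebra, so the universal property applies; point masses are
  traced by \<open>push_delta\<close>.\<close>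

theorem enveloping_functorial:
  "\<exists>\<sigma> \<in> star_hom (enveloping_cstar P.L) (enveloping_cstar Q.L). \<forall>s \<in> carrier P.
    \<sigma> (enveloping_map P.L (\<lambda>x. if x = s then 1 else 0)) = enveloping_map Q.L (\<lambda>x. if x = \<psi> s then 1 else 0)"
proof -
  interpret QL: normed_star_algebra Q.L by (rule Q.l1_normed)
  have "\<exists>\<sigma> \<in> star_hom (enveloping_cstar P.L) (enveloping_cstar Q.L).
    \<forall>a \<in> carrier P.L. \<sigma> (enveloping_map P.L a) = enveloping_map Q.L (push a)"
  proof (rule enveloping_cstar_universal[OF P.l1_normed QL.enveloping_cstar_algebra])
    show "(\<lambda>a. enveloping_map Q.L (push a)) \<in> star_hom P.L (enveloping_cstar Q.L)"
      by (rule star_hom_comp[OF push_star_hom QL.enveloping_map_star_hom])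
    show "nrm (enveloping_cstar Q.L) (enveloping_map Q.L (push a)) \<le> nrm P.L a"
      if a: "a \<in> carrier P.L" for a
      using QL.enveloping_map_contractive[OF push_closed[OF a]] push_contractive[OF a] by linarith
  qed
  then obtain \<sigma> where \<sigma>: "\<sigma> \<in> star_hom (enveloping_cstar P.L) (enveloping_cstar Q.L)"
    "\<And>a. a \<in> carrier P.L \<Longrightarrow> \<sigma> (enveloping_map P.L a) = enveloping_map Q.L (push a)" by blast
  then show ?thesis by (intro bexI[of _ \<sigma>]) (simp_all add: delta_closed push_delta)
qed

end

subsection \<open>Extending a homomorphism to the left inverse hull\<close>

locale reversible_hom = S: monoid S + G: group G
  for S :: "('s, 'm) monoid_scheme" and G :: "('g, 'n) monoid_scheme" +
  fixes \<phi> :: "'s \<Rightarrow> 'g"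
  assumes lc: "left_cancellative S" and lr: "left_reversible S"
    and hom: "\<phi> \<in> hom S G"
begin

abbreviation "I \<equiv> left_inverse_hull S"

lemma \<phi>_closed: "s \<in> carrier S \<Longrightarrow> \<phi> s \<in> carrier G"
  and \<phi>_mult: "s \<in> carrier S \<Longrightarrow> t \<in> carrier S \<Longrightarrow> \<phi> (s \<otimes>\<^bsub>S\<^esub> t) = \<phi> s \<otimes>\<^bsub>G\<^esub> \<phi> t"
  using hom by (auto simp: hom_def)

lemma common_multiple:
  assumes "s \<in> carrier S" "t \<in> carrier S"
  obtains x y where "x \<in> carrier S" "y \<in> carrier S" "s \<otimes>\<^bsub>S\<^esub> x = t \<otimes>\<^bsub>S\<^esub> y"
  using lr assms unfolding left_reversible_def l_coset_def by blast

lemma hull_in: "f \<in> carrier I \<Longrightarrow> f t = Some y \<Longrightarrow> t \<in> carrier S \<and> y \<in> carrier S"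
  using hull_pb[OF S.monoid_axioms lc, of f] unfolding pb_iff by blast

lemmas hull_carrier = hull_ops(3)[OF S.monoid_axioms lc]

lemma hull_pinv: "f \<in> carrier I \<Longrightarrow> partial_inv f y = Some x \<longleftrightarrow> f x = Some y"
  by (rule pinv[OF hull_pb[OF S.monoid_axioms lc]])

text \<open>\<phi> intertwines \<open>f\<close> with left multiplication by \<open>g\<close>. The
  empty map would be implemented by every group element, so uniqueness of \<open>g\<close> rests on
  \<open>hull_nonempty\<close>.\<close>

definition implements :: "'g \<Rightarrow> ('s \<rightharpoonup> 's) \<Rightarrow> bool" where
  "implements g f \<longleftrightarrow> g \<in> carrier G \<and> (\<forall>t y. f t = Some y \<longrightarrow> \<phi> y = g \<otimes>\<^bsub>G\<^esub> \<phi> t)"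

text \<open>Associativity gives this for left translations, and it survives composition and
  inversion.\<close>

lemma hull_equivariant:
  assumes "f \<in> carrier I" "f t = Some y" "x \<in> carrier S"
  shows "f (t \<otimes>\<^bsub>S\<^esub> x) = Some (y \<otimes>\<^bsub>S\<^esub> x)"
  using assms unfolding hull_carrier
proof (induction arbitrary: t y)
  case (incl f)
  then show ?case by (auto simp: left_translation_def S.m_assoc split: if_splits)
next
  case (comp f g)
  then show ?case by (auto simp: map_comp_Some_iff)
next
  case (inv f)
  then show ?case using hull_pinv[of f] by (simp add: hull_carrier)
qed

text \<open>For a composition, the domain of \<open>f\<close> and the range of \<open>g\<close> are
  nonempty and closed under right multiplication, so left reversibility makes them meet.\<close>

lemma hull_nonempty: "f \<in> carrier I \<Longrightarrow> \<exists>t y. f t = Some y"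
  unfolding hull_carrier
proof (induction rule: inverse_generate.induct)
  case (incl f)
  then show ?case by (auto simp: left_translation_def)
next
  case (comp f g)
  then obtain t y u v where e: "f t = Some y" "g u = Some v" by blast
  have fg: "f \<in> carrier I" "g \<in> carrier I" using comp by (simp_all add: hull_carrier)
  obtain x z where xz: "x \<in> carrier S" "z \<in> carrier S" "t \<otimes>\<^bsub>S\<^esub> x = v \<otimes>\<^bsub>S\<^esub> z"
    using common_multiple hull_in[OF fg(1) e(1)] hull_in[OF fg(2) e(2)] by blast
  \<comment> \<open>The common multiple of \<open>t\<close> and \<open>v\<close> is the value of
    \<open>g\<close> at this point and lies in the domain of \<open>f\<close>.\<close>
  then have "(f \<circ>\<^sub>m g) (u \<otimes>\<^bsub>S\<^esub> z) = Some (y \<otimes>\<^bsub>S\<^esub> x)"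
    using hull_equivariant[OF fg(1) e(1) xz(1)] hull_equivariant[OF fg(2) e(2) xz(2)]
    by (simp add: map_comp_Some_iff)
  then show ?case by blast
next
  case (inv f)
  then show ?case using hull_pinv[of f] by (auto simp: hull_carrier)
qed

lemma implements_translation: "s \<in> carrier S \<Longrightarrow> implements (\<phi> s) (left_translation S s)"
  by (auto simp: implements_def left_translation_def \<phi>_closed \<phi>_mult)

lemma implements_comp:
  assumes "implements g f" "implements h k" "k \<in> carrier I"
  shows "implements (g \<otimes>\<^bsub>G\<^esub> h) (f \<circ>\<^sub>m k)"
  using assms by (auto simp: implements_def map_comp_Some_iff G.m_assoc \<phi>_closed dest: hull_in)

lemma implements_inv:
  assumes "implements g f" "f \<in> carrier I"
  shows "implements (inv\<^bsub>G\<^esub> g) (partial_inv f)"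
  using assms by (auto simp: implements_def hull_pinv \<phi>_closed G.m_assoc[symmetric] dest: hull_in)

text \<open>Existence follows the generation of the hull; uniqueness follows by cancelling
  \<open>\<phi> t\<close> at any point \<open>t\<close> of the domain.\<close>

lemma implements_ex1: assumes "f \<in> carrier I" shows "\<exists>!g. implements g f"
proof (rule ex_ex1I)
  show "\<exists>g. implements g f"
    using assms unfolding hull_carrier
  proof (induction rule: inverse_generate.induct)
    case (incl f)
    then show ?case using implements_translation by auto
  next
    case (comp f g)
    then show ?case using implements_comp by (metis hull_carrier)
  next
    case (inv f)
    then show ?case using implements_inv by (metis hull_carrier)
  qed
  fix g h assume gh: "implements g f" "implements h f"
  obtain t y where t: "f t = Some y" using hull_nonempty[OF assms] by blast
  then have "g \<otimes>\<^bsub>G\<^esub> \<phi> t = h \<otimes>\<^bsub>G\<^esub> \<phi> t" using gh unfolding implements_def by metis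
  then show "g = h" using gh hull_in[OF assms t] by (simp add: implements_def \<phi>_closed)
qed

text \<open>An element of the hull may arise from many words in the generators; the description
  through \<open>implements\<close> avoids choosing one.\<close>

definition hull_extension :: "('s \<rightharpoonup> 's) \<Rightarrow> 'g" where
  "hull_extension f = (THE g. implements g f)"

lemma hull_extension: "f \<in> carrier I \<Longrightarrow> implements (hull_extension f) f"
  unfolding hull_extension_def by (rule theI'[OF implements_ex1])

lemma hull_extension_eq: "f \<in> carrier I \<Longrightarrow> implements g f \<Longrightarrow> hull_extension f = g"
  using hull_extension implements_ex1 by blast

lemma translation_in_hull: "s \<in> carrier S \<Longrightarrow> left_translation S s \<in> carrier I"
  by (auto simp: hull_carrier intro: inverse_generate.incl)

lemma hull_extension_translation: "s \<in> carrier S \<Longrightarrow> hull_extension (left_translation S s) = \<phi> s"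
  by (intro hull_extension_eq translation_in_hull implements_translation)

text \<open>By uniqueness it is enough that products and inverses of implementing elements implement
  the compositions and inverse maps.\<close>

lemma hull_extension_hom: "involutive_monoid_hom I (semigroup_inv I) G (m_inv G) hull_extension"
proof (intro involutive_monoid_hom.intro involutive_monoid_hom_axioms.intro)
  show "involutive_monoid I (semigroup_inv I)" by (rule hull_involutive[OF S.monoid_axioms lc])
  show "involutive_monoid G (m_inv G)" by unfold_locales (simp_all add: G.inv_mult_group)
  show "hull_extension \<in> hom I G"
  proof (rule homI)
    fix f k assume f: "f \<in> carrier I"
    then show "hull_extension f \<in> carrier G" using hull_extension by (auto simp: implements_def)
    assume k: "k \<in> carrier I"
    have "f \<circ>\<^sub>m k \<in> carrier I" using f k unfolding hull_carrier by (rule inverse_generate.comp)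
    then show "hull_extension (f \<otimes>\<^bsub>I\<^esub> k) = hull_extension f \<otimes>\<^bsub>G\<^esub> hull_extension k"
      unfolding hull_ops(1)[OF S.monoid_axioms lc]
      using f k by (intro hull_extension_eq implements_comp hull_extension)
  qed
  fix f assume f: "f \<in> carrier I"
  then have "partial_inv f \<in> carrier I" unfolding hull_carrier by (rule inverse_generate.inv)
  then show "hull_extension (semigroup_inv I f) = inv\<^bsub>G\<^esub> hull_extension f"
    unfolding hull_semigroup_inv[OF S.monoid_axioms lc f]
    using f by (intro hull_extension_eq implements_inv hull_extension)
qed

end

theorem corollary3p4p11:
  fixes S :: "('s, 'm) monoid_scheme" and G :: "('g, 'n) monoid_scheme" and \<phi> :: "'s \<Rightarrow> 'g"
  assumes "monoid S" and "left_cancellative S" and "left_reversible S"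
    and "group G"
    and "\<phi> \<in> hom S G" and "\<phi> \<one>\<^bsub>S\<^esub> = \<one>\<^bsub>G\<^esub>"
  shows "\<exists>\<pi> \<in> star_hom (inverse_semigroup_cstar (left_inverse_hull S)) (group_cstar G).
    \<forall>s \<in> carrier S.
      \<pi> (inverse_semigroup_elt (left_inverse_hull S) (left_translation S s)) = group_elt G (\<phi> s)"
proof -
  interpret S: monoid S by fact
  interpret G: group G by fact
  interpret reversible_hom S G \<phi> by unfold_locales (fact assms)+
  interpret involutive_monoid_hom I "semigroup_inv I" G "m_inv G" hull_extension
    by (rule hull_extension_hom)
  obtain \<sigma> where \<sigma>: "\<sigma> \<in> star_hom (inverse_semigroup_cstar I) (group_cstar G)"
    "\<And>f. f \<in> carrier I \<Longrightarrow> \<sigma> (inverse_semigroup_elt I f) = group_elt G (hull_extension f)"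
    \<comment> \<open>Both C*-algebras are by definition enveloping algebras of convolution
      algebras, with point masses as canonical elements.\<close>
    using enveloping_functorial
    unfolding inverse_semigroup_cstar_def group_cstar_def inverse_semigroup_elt_def group_elt_def by blast
  then show ?thesis
    by (intro bexI[of _ \<sigma>]) (simp_all add: translation_in_hull hull_extension_translation)
qed

end
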